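(* Let $d\ge 2$ and $n\ge 1$ be integers. The Pauli growth $G$, defined on unitary operators on $n$ qudits of local dimension $d$, satisfies: 1. (Faithfulness) $G(V)\ge 0$ for every $n$-qudit unitary $V$; and for an $n$-qudit unitary $U$, $G(U)=0$ if and only if $U$ is a non-entangling unitary. 2. (Invariance) $G(U_1VU_2)=G(V)$ for every $n$-qudit unitary $V$ and all non-entangling $n$-qudit unitaries $U_1,U_2$.
   Context: Pauli operators: on $\mathbb{C}^d$ with basis $|0\rangle,\dots,|d-1\rangle$ let $X|j\rangle=|j+1 \bmod d\rangle$ and $Z|j\rangle=e^{2\pi i j/d}|j\rangle$. Let $\mathcal{V}_d=\mathbb{Z}_d\times\mathbb{Z}_d$. For $a=(s,t)\in\mathcal{V}_d$ put $P_a=X^sZ^t$, and for $\vec a=(a_1,\dots,a_n)\in\mathcal{V}_d^n$ put $P_{\vec a}=P_{a_1}\otimes\cdots\otimes P_{a_n}$, acting on $(\mathbb{C}^d)^{\otimes n}$. The Pauli weight $|\vec a|$ is the number of indices $j$ with $a_j\ne(0,0)$; a weight-1 Pauli operator is a $P_{\vec a}$ with $|\vec a|=1$. Inner product and norm on $n$-qudit operators: $\langle O_1,O_2\rangle=\frac{1}{d^n}\mathrm{Tr}(O_1^\dagger O_2)$ and $\|O\|_2=\sqrt{\langle O,O\rangle}$. The $P_{\vec a}$ form an orthonormal basis. Average Pauli weight: for an operator $O$ with $\|O\|_2=1$ and Pauli expansion $O=\sum_{\vec a}c_{\vec a}P_{\vec a}$, set $W(O)=\sum_{\vec a\in\mathcal{V}_d^n}|\vec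 a|\,|c_{\vec a}|^2$. Pauli growth: for an $n$-qudit unitary $U$, $$G(U)=\max\{\,W(U^\dagger OU)-1 \;:\; \|O\|_2=1,\ W(O)=1,\ \mathrm{Tr}(O)=0\,\},$$ where $O$ ranges over linear operators on $(\mathbb{C}^d)^{\otimes n}$. Non-entangling unitary: a unitary $U$ such that $W(U^\dagger PU)=1$ for every weight-1 Pauli operator $P$. *)

theory Defs
  imports
    Complex_Main
    "HOL-Library.FuncSet"
    "Jordan_Normal_Form.Matrix"
    "Jordan_Normal_Form.Schur_Decomposition"
begin

text \<open>
  Operators on \<open>n\<close> qudits of local dimension \<open>d\<close> are complex \<open>d^n \<times> d^n\<close> matrices; the basis
  vector \<open>|j\<^sub>1,\<dots>,j\<^sub>n\<rangle>\<close> has as its index the number with base-\<open>d\<close> digits \<open>j\<^sub>1 \<dots> j\<^sub>n\<close>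
  (most significant first). Elements of \<open>\<int>\<^sub>d\<close> are represented by \<open>0, \<dots>, d - 1\<close>.
\<close>

definition n_qudit_ops :: "nat \<Rightarrow> nat \<Rightarrow> complex mat set" where
  "n_qudit_ops d n = carrier_mat (d ^ n) (d ^ n)"

definition mat_trace :: "complex mat \<Rightarrow> complex" where
  "mat_trace A = (\<Sum>i<dim_row A. A $$ (i, i))"

definition kronecker :: "complex mat \<Rightarrow> complex mat \<Rightarrow> complex mat" where
  "kronecker A B = mat (dim_row A * dim_row B) (dim_col A * dim_col B)
     (\<lambda>(i, j). A $$ (i div dim_row B, j div dim_col B) * B $$ (i mod dim_row B, j mod dim_col B))"

definition shift_X :: "nat \<Rightarrow> complex mat" where
  "shift_X d = mat d d (\<lambda>(i, j). if i = (j + 1) mod d then 1 else 0)"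

definition clock_Z :: "nat \<Rightarrow> complex mat" where
  "clock_Z d = mat d d (\<lambda>(i, j). if i = j then cis (2 * pi * real j / real d) else 0)"

definition pauli1 :: "nat \<Rightarrow> nat \<times> nat \<Rightarrow> complex mat" where
  "pauli1 d a = (shift_X d ^\<^sub>m fst a) * (clock_Z d ^\<^sub>m snd a)"

definition pauli_labels :: "nat \<Rightarrow> nat \<Rightarrow> (nat \<times> nat) list set" where
  "pauli_labels d n = {as. length as = n \<and> set as \<subseteq> {0..<d} \<times> {0..<d}}"

definition pauli :: "nat \<Rightarrow> (nat \<times> nat) list \<Rightarrow> complex mat" where
  "pauli d as = foldr kronecker (map (pauli1 d) as) (1\<^sub>m 1)"

definition pauli_weight :: "(nat \<times> nat) list \<Rightarrow> nat" where
  "pauli_weight as = card {j. j < length as \<and> as ! j \<noteq> (0, 0)}"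

definition op_inner :: "nat \<Rightarrow> nat \<Rightarrow> complex mat \<Rightarrow> complex mat \<Rightarrow> complex" where
  "op_inner d n A B = 1 / of_nat (d ^ n) * mat_trace (mat_adjoint A * B)"

text \<open>The value \<open>\<langle>A, A\<rangle>\<close> is real and nonnegative, so taking its real part loses nothing.\<close>

definition op_norm2 :: "nat \<Rightarrow> nat \<Rightarrow> complex mat \<Rightarrow> real" where
  "op_norm2 d n A = sqrt (Re (op_inner d n A A))"

text \<open>
  The coefficient family of the expansion \<open>A = (\<Sum>as. c as \<cdot> P\<^sub>a\<^sub>s)\<close>, written entrywise. It exists and is
  unique on \<^term>\<open>pauli_labels d n\<close> since the Pauli operators form a basis; extensionality fixes
  the irrelevant values outside \<^term>\<open>pauli_labels d n\<close>.
\<close>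

definition pauli_coeffs :: "nat \<Rightarrow> nat \<Rightarrow> complex mat \<Rightarrow> (nat \<times> nat) list \<Rightarrow> complex" where
  "pauli_coeffs d n A = (THE c. c \<in> extensional (pauli_labels d n) \<and>
     A = mat (d ^ n) (d ^ n) (\<lambda>(i, j). \<Sum>as\<in>pauli_labels d n. c as * pauli d as $$ (i, j)))"

definition avg_weight :: "nat \<Rightarrow> nat \<Rightarrow> complex mat \<Rightarrow> real" where
  "avg_weight d n A =
     (\<Sum>as\<in>pauli_labels d n. real (pauli_weight as) * (cmod (pauli_coeffs d n A as))\<^sup>2)"

definition is_unitary :: "nat \<Rightarrow> nat \<Rightarrow> complex mat \<Rightarrow> bool" where
  "is_unitary d n U \<longleftrightarrow> U \<in> n_qudit_ops d n \<and>
     mat_adjoint U * U = 1\<^sub>m (d ^ n) \<and> U * mat_adjoint U = 1\<^sub>m (d ^ n)"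

definition growth_values :: "nat \<Rightarrow> nat \<Rightarrow> complex mat \<Rightarrow> real set" where
  "growth_values d n U = {avg_weight d n (mat_adjoint U * A * U) - 1 | A.
     A \<in> n_qudit_ops d n \<and> op_norm2 d n A = 1 \<and> avg_weight d n A = 1 \<and> mat_trace A = 0}"

text \<open>
  The maximum is over an infinite set, so \<^const>\<open>Max\<close> does not apply. \<open>GREATEST\<close> denotes the
  greatest element, which is attained, as opposed to a mere supremum.
\<close>

definition pauli_growth :: "nat \<Rightarrow> nat \<Rightarrow> complex mat \<Rightarrow> real" where
  "pauli_growth d n U = (GREATEST g. g \<in> growth_values d n U)"

definition non_entangling :: "nat \<Rightarrow> nat \<Rightarrow> complex mat \<Rightarrow> bool" where
  "non_entangling d n U \<longleftrightarrow> is_unitary d n U \<and>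
     (\<forall>as\<in>pauli_labels d n. pauli_weight as = 1 \<longrightarrow>
        avg_weight d n (mat_adjoint U * pauli d as * U) = 1)"

end

theory Submission
  imports "HOL-Analysis.Function_Topology" "HOL-Analysis.Topology_Euclidean_Space" Defs
begin

text \<open>
  Let \<open>S\<close> be the span of the weight-one Pauli operators. A traceless unit operator has average
  weight at least \<open>1\<close>, with equality exactly on \<open>S\<close>, so \<open>G(U)\<close> is the maximum of a continuous
  nonnegative function on the unit sphere of \<open>S\<close>, and it vanishes iff \<open>A \<mapsto> U\<^sup>*AU\<close> maps \<open>S\<close> into \<open>S\<close>.

  For non-entangling \<open>U\<close> this map is then a unitary bijection of \<open>S\<close>, so that \<open>U\<^sup>*\<close> is non-entangling
  too. That \<open>W(U\<^sup>*AU) = W(A)\<close> for all \<open>A\<close> does not need the structure of non-entangling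
  unitaries: summing \<open>P A P\<^sup>*\<close> over all Pauli operators of one site depolarizes that site, hence
  \<open>d\<^sup>2 W(A) = (d\<^sup>2 - 1) n \<parallel>A\<parallel>\<^sup>2 - (\<Sum>\<^sub>P \<langle>A, P A P\<^sup>*\<rangle>)\<close> with \<open>P\<close> ranging over the weight-one Pauli
  operators, and the last sum, being the trace on \<open>S\<close> of the compression of \<open>X \<mapsto> A\<^sup>*XA\<close>, takes the
  same value on every orthonormal basis of \<open>S\<close>, in particular on the operators \<open>U\<^sup>*PU\<close>.
\<close>

subsection \<open>Adjoints, traces and Kronecker products\<close>

text \<open>An index of a Kronecker product is a pair of quotient and remainder by \<open>k\<close>.
  Reindexing by such pairs turns sums over tensor-product indices into double sums that
  factor.\<close>

lemma sum_prod_split: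
  fixes f :: "nat \<Rightarrow> nat \<Rightarrow> 'a::comm_monoid_add"
  shows "(\<Sum>i<m * k. f (i div k) (i mod k)) = (\<Sum>i<m. \<Sum>j<k. f i j)"
proof -
  have "(\<Sum>i<m * k. f (i div k) (i mod k)) = (\<Sum>i<m. \<Sum>l=i*k..<i*k+k. f (l div k) (l mod k))"
    by (rule sum.nat_group[symmetric])
  also have "\<dots> = (\<Sum>i<m. \<Sum>j<k. f i j)"
  proof (rule sum.cong[OF refl])
    fix i
    have "(\<Sum>l=i*k..<i*k+k. f (l div k) (l mod k)) = (\<Sum>j<k. f ((j + i*k) div k) ((j + i*k) mod k))"
      using sum.shift_bounds_nat_ivl[of "\<lambda>l. f (l div k) (l mod k)" 0 "i*k" k]
      by (simp add: lessThan_atLeast0 add.commute)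
    also have "\<dots> = (\<Sum>j<k. f i j)"
      by (intro sum.cong) auto
    finally show "(\<Sum>l=i*k..<i*k+k. f (l div k) (l mod k)) = (\<Sum>j<k. f i j)" .
  qed
  finally show ?thesis .
qed

lemma dim_mat_adjoint [simp]:
  "dim_row (mat_adjoint A) = dim_col A" "dim_col (mat_adjoint A) = dim_row A"
  by (simp_all add: mat_adjoint_def)

lemma index_mat_adjoint [simp]:
  assumes "i < dim_col A" "j < dim_row A"
  shows "mat_adjoint A $$ (i, j) = cnj (A $$ (j, i))"
  using assms by (simp add: mat_adjoint_def mat_of_rows_index)

lemma mat_adjoint_carrier [simp]: "A \<in> carrier_mat m k \<Longrightarrow> mat_adjoint A \<in> carrier_mat k m"
  by (intro carrier_matI) auto

lemma mat_adjoint_adjoint [simp]: "mat_adjoint (mat_adjoint A) = (A :: complex mat)"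
  by (rule eq_matI) auto

lemma mat_adjoint_mult:
  fixes A B :: "complex mat"
  assumes "A \<in> carrier_mat m k" "B \<in> carrier_mat k l"
  shows "mat_adjoint (A * B) = mat_adjoint B * mat_adjoint A"
  using assms by (intro eq_matI) (auto simp: scalar_prod_def mult.commute intro!: sum.cong)

lemma mat_adjoint_one [simp]: "mat_adjoint (1\<^sub>m m) = (1\<^sub>m m :: complex mat)"
  by (rule eq_matI) auto

lemma trace_mult:
  assumes "A \<in> carrier_mat m k" "B \<in> carrier_mat k m"
  shows "mat_trace (A * B) = (\<Sum>i<m. \<Sum>j<k. A $$ (i, j) * B $$ (j, i))"
  using assms by (auto simp: mat_trace_def scalar_prod_def lessThan_atLeast0 intro!: sum.cong)

lemma trace_commute:
  assumes "A \<in> carrier_mat m k" "B \<in> carrier_mat k m"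
  shows "mat_trace (A * B) = mat_trace (B * A)"
  unfolding trace_mult[OF assms] trace_mult[OF assms(2,1)]
  by (subst sum.swap) (simp add: mult.commute)

lemma trace_adjoint_mult:
  assumes "A \<in> carrier_mat m k" "B \<in> carrier_mat m k"
  shows "mat_trace (mat_adjoint A * B) = (\<Sum>i<m. \<Sum>j<k. cnj (A $$ (i, j)) * B $$ (i, j))"
proof -
  have "mat_trace (mat_adjoint A * B) = (\<Sum>j<k. \<Sum>i<m. mat_adjoint A $$ (j, i) * B $$ (i, j))"
    using assms by (intro trace_mult) auto
  also have "\<dots> = (\<Sum>j<k. \<Sum>i<m. cnj (A $$ (i, j)) * B $$ (i, j))"
    using assms by (intro sum.cong refl) auto
  finally show ?thesis by (subst sum.swap)
qed

lemma kronecker_carrier [simp]: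
  "A \<in> carrier_mat m k \<Longrightarrow> B \<in> carrier_mat m' k' \<Longrightarrow> kronecker A B \<in> carrier_mat (m * m') (k * k')"
  by (auto simp: kronecker_def)

lemma dim_kronecker [simp]:
  "dim_row (kronecker A B) = dim_row A * dim_row B" "dim_col (kronecker A B) = dim_col A * dim_col B"
  by (simp_all add: kronecker_def)

lemma index_kronecker:
  assumes "i < dim_row A * dim_row B" "j < dim_col A * dim_col B"
  shows "kronecker A B $$ (i, j) =
    A $$ (i div dim_row B, j div dim_col B) * B $$ (i mod dim_row B, j mod dim_col B)"
  using assms by (simp add: kronecker_def)

lemma div_mod_less_product:
  assumes "i < m * (k::nat)"
  shows "i div k < m" "i mod k < k"
  using assms by (auto simp: less_mult_imp_div_less) (metis less_nat_zero_code mod_less_divisor mult_0_right neq0_conv)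

lemma kronecker_adjoint: "mat_adjoint (kronecker A B) = kronecker (mat_adjoint A) (mat_adjoint B)"
  by (rule eq_matI) (auto simp: index_kronecker div_mod_less_product)

lemma kronecker_mult:
  assumes "A \<in> carrier_mat m k" "B \<in> carrier_mat m' k'" "C \<in> carrier_mat k l" "D \<in> carrier_mat k' l'"
  shows "kronecker A B * kronecker C D = kronecker (A * C) (B * D)"
proof (rule eq_matI)
  fix i j assume "i < dim_row (kronecker (A * C) (B * D))" "j < dim_col (kronecker (A * C) (B * D))"
  then have i: "i < m * m'" and j: "j < l * l'" using assms by auto
  note ij = div_mod_less_product[OF i] div_mod_less_product[OF j]
  have "(kronecker A B * kronecker C D) $$ (i, j) =
      (\<Sum>h<k * k'. A $$ (i div m', h div k') * B $$ (i mod m', h mod k') *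
                 (C $$ (h div k', j div l') * D $$ (h mod k', j mod l')))"
    using assms i j by (simp add: scalar_prod_def index_kronecker lessThan_atLeast0)
  also have "\<dots> = (\<Sum>p<k. \<Sum>q<k'. A $$ (i div m', p) * B $$ (i mod m', q) *
                 (C $$ (p, j div l') * D $$ (q, j mod l')))"
    by (rule sum_prod_split)
  also have "\<dots> = (\<Sum>p<k. A $$ (i div m', p) * C $$ (p, j div l')) *
                 (\<Sum>q<k'. B $$ (i mod m', q) * D $$ (q, j mod l'))"
    by (simp add: sum_product mult.assoc mult.left_commute)
  also have "\<dots> = kronecker (A * C) (B * D) $$ (i, j)"
    using assms i j ij by (simp add: index_kronecker scalar_prod_def lessThan_atLeast0)
  finally show "(kronecker A B * kronecker C D) $$ (i, j) = kronecker (A * C) (B * D) $$ (i, j)" .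
qed (use assms in auto)

lemma trace_kronecker:
  assumes "A \<in> carrier_mat m m" "B \<in> carrier_mat k k"
  shows "mat_trace (kronecker A B) = mat_trace A * mat_trace B"
proof -
  have "mat_trace (kronecker A B) = (\<Sum>i<m * k. A $$ (i div k, i div k) * B $$ (i mod k, i mod k))"
    using assms by (auto simp: mat_trace_def index_kronecker intro!: sum.cong)
  also have "\<dots> = (\<Sum>p<m. \<Sum>q<k. A $$ (p, p) * B $$ (q, q))"
    by (rule sum_prod_split)
  finally show ?thesis
    using assms by (simp add: mat_trace_def sum_product)
qed

subsection \<open>Single-site Pauli operators\<close>

text \<open>For \<open>a\<close> different from \<open>b\<close> the terms are the powers of a
  nontrivial \<open>d\<close>-th root of unity \<open>w\<close>, so the geometric sum
  vanishes.\<close>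

lemma sum_roots_of_unity_orthogonal:
  assumes "a < d" "b < d"
  shows "(\<Sum>j<d. cis (2 * pi * real a * real j / real d) * cnj (cis (2 * pi * real b * real j / real d)))
    = (if a = b then of_nat d else 0)"
proof (cases "a = b")
  case True
  then show ?thesis by (simp add: cis_cnj cis_mult)
next
  case False
  define w where "w = cis (2 * pi * (real a - real b) / real d)"
  have d: "d > 0" using assms by simp
  have "w = cis (2 * pi * real a / real d) / cis (2 * pi * real b / real d)"
    by (simp add: w_def cis_divide right_diff_distrib diff_divide_distrib)
  \<comment> \<open>The exponents below \<open>d\<close> enumerate the \<open>d\<close>-th roots of
    unity without repetition.\<close>
  moreover have "cis (2 * pi * real a / real d) \<noteq> cis (2 * pi * real b / real d)"
    using bij_betw_imp_inj_on[OF bij_betw_roots_unity[OF d]] assms False by (auto dest: inj_onD)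
  ultimately have "w \<noteq> 1" by simp
  have "w ^ d = cis (2 * pi * (real a - real b))"
    using d by (simp add: w_def DeMoivre)
  also have "\<dots> = 1" by (intro cis_multiple_2pi) auto
  finally have "w ^ d = 1" .
  have "(\<Sum>j<d. cis (2 * pi * real a * real j / real d) * cnj (cis (2 * pi * real b * real j / real d)))
     = (\<Sum>j<d. w ^ j)"
    by (intro sum.cong refl) (simp add: w_def DeMoivre cis_cnj cis_mult algebra_simps diff_divide_distrib)
  also have "\<dots> = 0" using \<open>w \<noteq> 1\<close> \<open>w ^ d = 1\<close> by (simp add: geometric_sum)
  finally show ?thesis using False by simp
qed

lemma shift_X_power:
  "shift_X d ^\<^sub>m s = mat d d (\<lambda>(i, j). if i = (j + s) mod d then 1 else 0)"
proof (induction s)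
  case 0
  show ?case by (rule eq_matI) (auto simp: shift_X_def)
next
  case (Suc s)
  show ?case
  proof (rule eq_matI)
    fix i j assume "i < dim_row (mat d d (\<lambda>(i, j). if i = (j + Suc s) mod d then 1 else (0::complex)))"
      "j < dim_col (mat d d (\<lambda>(i, j). if i = (j + Suc s) mod d then 1 else (0::complex)))"
    then have ij: "i < d" "j < d" by auto
    have "(shift_X d ^\<^sub>m Suc s) $$ (i, j) =
      (\<Sum>k<d. (if i = (k + s) mod d then 1 else 0) * (if k = (j + 1) mod d then 1 else 0))"
      unfolding pow_mat.simps Suc using ij by (simp add: shift_X_def scalar_prod_def lessThan_atLeast0)
    also have "\<dots> = (\<Sum>k<d. if k = (j + 1) mod d then (if i = (k + s) mod d then 1 else 0) else 0)"
      by (intro sum.cong) auto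
    also have "\<dots> = (if i = (j + Suc s) mod d then 1 else 0)"
      using ij by (simp add: mod_simps)
    finally show "(shift_X d ^\<^sub>m Suc s) $$ (i, j) =
        mat d d (\<lambda>(i, j). if i = (j + Suc s) mod d then 1 else 0) $$ (i, j)"
      using ij by simp
  qed (auto simp: Suc shift_X_def)
qed

lemma clock_Z_power:
  "clock_Z d ^\<^sub>m t = mat d d (\<lambda>(i, j). if i = j then cis (2 * pi * real t * real j / real d) else 0)"
proof (induction t)
  case 0
  show ?case by (rule eq_matI) (auto simp: clock_Z_def)
next
  case (Suc t)
  show ?case
  proof (rule eq_matI)
    fix i j assume "i < dim_row (mat d d (\<lambda>(i, j). if i = j then cis (2 * pi * real (Suc t) * real j / real d) else 0))"
      "j < dim_col (mat d d (\<lambda>(i, j). if i = j then cis (2 * pi * real (Suc t) * real j / real d) else 0))"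
    then have ij: "i < d" "j < d" by auto
    have "(clock_Z d ^\<^sub>m Suc t) $$ (i, j) =
      (\<Sum>k<d. (if i = k then cis (2 * pi * real t * real k / real d) else 0) *
             (if k = j then cis (2 * pi * real j / real d) else 0))"
      unfolding pow_mat.simps Suc using ij by (simp add: clock_Z_def scalar_prod_def lessThan_atLeast0)
    also have "\<dots> = (\<Sum>k<d. if k = j then (if i = k then cis (2 * pi * real t * real k / real d) else 0) *
             cis (2 * pi * real j / real d) else 0)"
      by (intro sum.cong) auto
    also have "\<dots> = (if i = j then cis (2 * pi * real (Suc t) * real j / real d) else 0)"
      using ij by (auto simp: cis_mult algebra_simps add_divide_distrib)
    finally show "(clock_Z d ^\<^sub>m Suc t) $$ (i, j) =
        mat d d (\<lambda>(i, j). if i = j then cis (2 * pi * real (Suc t) * real j / real d) else 0) $$ (i, j)"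
      using ij by simp
  qed (auto simp: Suc clock_Z_def)
qed

lemma pauli1_carrier [simp]: "pauli1 d a \<in> carrier_mat d d"
  by (auto simp: pauli1_def shift_X_power clock_Z_power)

lemma dim_pauli1 [simp]: "dim_row (pauli1 d a) = d" "dim_col (pauli1 d a) = d"
  using pauli1_carrier[of d a] by (simp_all only: carrier_matD)

lemma pauli1_index:
  assumes "i < d" "j < d"
  shows "pauli1 d (s, t) $$ (i, j) =
    (if i = (j + s) mod d then cis (2 * pi * real t * real j / real d) else 0)"
proof -
  have "pauli1 d (s, t) $$ (i, j) = (\<Sum>k<d. (if i = (k + s) mod d then 1 else 0) *
      (if k = j then cis (2 * pi * real t * real j / real d) else 0))"
    using assms by (simp add: pauli1_def shift_X_power clock_Z_power scalar_prod_def lessThan_atLeast0)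
  also have "\<dots> = (\<Sum>k<d. if k = j then (if i = (k + s) mod d then 1 else 0) *
      cis (2 * pi * real t * real j / real d) else 0)"
    by (intro sum.cong) auto
  finally show ?thesis using assms by simp
qed

text \<open>Serves to show that distinct powers of \<open>shift_X\<close> have disjoint supports.
  The proof passes to the integers, where subtraction does not truncate.\<close>

lemma add_mod_left_cancel:
  fixes j s s' d :: nat
  assumes "s < d" "s' < d" "(j + s) mod d = (j + s') mod d"
  shows "s = s'"
proof -
  have "(int j + int s) mod int d = (int j + int s') mod int d"
    using assms(3) by (metis of_nat_add of_nat_mod)
  then have "int s mod int d = int s' mod int d"
    by (metis add_diff_cancel_left' mod_diff_left_eq)
  then show ?thesis using assms by simp
qed

lemma pauli1_zero: "pauli1 d (0, 0) = 1\<^sub>m d"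
  by (rule eq_matI) (auto simp: pauli1_index)

abbreviation sites :: "nat \<Rightarrow> (nat \<times> nat) set" where
  "sites d \<equiv> {0..<d} \<times> {0..<d}"

text \<open>Each column has a single nonzero entry, in a row fixed by the shift \<open>s\<close>.
  Different shifts thus have disjoint supports, and for equal shifts the phases are orthogonal
  characters.\<close>

lemma pauli1_orthogonal:
  assumes "a \<in> sites d" "b \<in> sites d"
  shows "mat_trace (mat_adjoint (pauli1 d a) * pauli1 d b) = (if a = b then of_nat d else 0)"
proof -
  obtain s t s' t' where ab: "a = (s, t)" "b = (s', t')" "s < d" "t < d" "s' < d" "t' < d"
    using assms by auto
  have "mat_trace (mat_adjoint (pauli1 d a) * pauli1 d b) =
      (\<Sum>i<d. \<Sum>j<d. cnj (pauli1 d a $$ (i, j)) * pauli1 d b $$ (i, j))"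
    by (rule trace_adjoint_mult) auto
  also have "\<dots> = (\<Sum>j<d. \<Sum>i<d. cnj (pauli1 d a $$ (i, j)) * pauli1 d b $$ (i, j))"
    by (rule sum.swap)
  also have "\<dots> = (\<Sum>j<d. \<Sum>i<d. if i = (j + s) mod d then (if s = s' then
      cis (2 * pi * real t' * real j / real d) * cnj (cis (2 * pi * real t * real j / real d)) else 0) else 0)"
    using ab by (intro sum.cong refl) (auto simp: pauli1_index dest: add_mod_left_cancel)
  also have "\<dots> = (if s = s' then (\<Sum>j<d. cis (2 * pi * real t' * real j / real d) *
      cnj (cis (2 * pi * real t * real j / real d))) else 0)"
    using ab by auto
  also have "\<dots> = (if a = b then of_nat d else 0)"
    using ab sum_roots_of_unity_orthogonal[of t' d t] by auto
  finally show ?thesis .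
qed

text \<open>The dual of orthogonality; it takes the place of a dimension count in showing that the
  Pauli operators span. Only the shift \<open>s0\<close> from column \<open>j\<close> to row
  \<open>i\<close> contributes, and the sum over the phase exponent forces
  \<open>j = l\<close>.\<close>

lemma pauli1_complete:
  assumes "i < d" "j < d" "k < d" "l < d"
  shows "(\<Sum>a\<in>sites d. pauli1 d a $$ (i, j) * cnj (pauli1 d a $$ (k, l))) =
    (if i = k \<and> j = l then of_nat d else 0)"
proof -
  have ex: "\<exists>s<d. (j + s) mod d = i"
  proof (cases "j \<le> i")
    case True
    then show ?thesis using assms by (intro exI[of _ "i - j"]) auto
  next
    case False
    then show ?thesis using assms by (intro exI[of _ "i + d - j"]) auto
  qed
  then obtain s0 where s0: "s0 < d" "(j + s0) mod d = i" by auto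
  have "(\<Sum>a\<in>sites d. pauli1 d a $$ (i, j) * cnj (pauli1 d a $$ (k, l))) =
    (\<Sum>s<d. \<Sum>t<d. pauli1 d (s, t) $$ (i, j) * cnj (pauli1 d (s, t) $$ (k, l)))"
    by (simp add: sum.cartesian_product lessThan_atLeast0)
  also have "\<dots> = (\<Sum>s<d. if s = s0 then (if k = (l + s) mod d then
      (\<Sum>t<d. cis (2 * pi * real j * real t / real d) * cnj (cis (2 * pi * real l * real t / real d))) else 0) else 0)"
  proof (rule sum.cong[OF refl])
    fix s assume "s \<in> {..<d}"
    then have "(i = (j + s) mod d) = (s = s0)" using s0 by (auto dest: add_mod_left_cancel)
    \<comment> \<open>Commuting the factors in the phase makes \<open>t\<close> the summation
      variable and \<open>j\<close>, \<open>l\<close> the frequencies, as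
      \<open>sum_roots_of_unity_orthogonal\<close> requires.\<close>
    then show "(\<Sum>t<d. pauli1 d (s, t) $$ (i, j) * cnj (pauli1 d (s, t) $$ (k, l))) =
      (if s = s0 then (if k = (l + s) mod d then (\<Sum>t<d. cis (2 * pi * real j * real t / real d) *
        cnj (cis (2 * pi * real l * real t / real d))) else 0) else 0)"
      using assms by (simp add: pauli1_index mult.assoc mult.commute[of "real j"] mult.commute[of "real l"])
  qed
  also have "\<dots> = (if k = (l + s0) mod d then (if j = l then of_nat d else 0) else 0)"
    using s0 assms by (simp only: sum_roots_of_unity_orthogonal) simp
  also have "\<dots> = (if i = k \<and> j = l then of_nat d else 0)"
    using s0 by auto
  finally show ?thesis .
qed

subsection \<open>Tensor products of Pauli operators\<close>

lemma pauli_labels_0 [simp]: "pauli_labels d 0 = {[]}"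
  by (auto simp: pauli_labels_def)

lemma pauli_labels_Suc: "pauli_labels d (Suc n) = (\<lambda>(x, xs). x # xs) ` (sites d \<times> pauli_labels d n)"
  by (auto simp: pauli_labels_def length_Suc_conv image_iff)

lemma finite_pauli_labels [simp]: "finite (pauli_labels d n)"
  by (induction n) (auto simp: pauli_labels_Suc)

lemma Cons_in_pauli_labels:
  "x # xs \<in> pauli_labels d (Suc n) \<longleftrightarrow> x \<in> sites d \<and> xs \<in> pauli_labels d n"
  by (auto simp: pauli_labels_def)

lemma pauli_labels_SucE:
  assumes "as \<in> pauli_labels d (Suc n)"
  obtains x xs where "as = x # xs" "x \<in> sites d" "xs \<in> pauli_labels d n"
  using assms by (auto simp: pauli_labels_Suc)

lemma sum_pauli_labels_Suc:
  "(\<Sum>as\<in>pauli_labels d (Suc n). f as) = (\<Sum>x\<in>sites d. \<Sum>xs\<in>pauli_labels d n. f (x # xs))"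
  unfolding pauli_labels_Suc
  by (subst sum.reindex) (auto simp: inj_on_def sum.cartesian_product intro!: sum.cong)

lemma pauli_Nil [simp]: "pauli d [] = 1\<^sub>m 1"
  by (simp add: pauli_def)

lemma pauli_Cons: "pauli d (a # as) = kronecker (pauli1 d a) (pauli d as)"
  by (simp add: pauli_def)

lemma pauli_carrier_length: "pauli d as \<in> carrier_mat (d ^ length as) (d ^ length as)"
  by (induction as) (auto simp: pauli_Cons intro!: kronecker_carrier)

lemma pauli_carrier [simp]: "as \<in> pauli_labels d n \<Longrightarrow> pauli d as \<in> carrier_mat (d ^ n) (d ^ n)"
  using pauli_carrier_length[of d as] by (auto simp: pauli_labels_def)

lemma pauli_orthogonal:
  assumes "as \<in> pauli_labels d n" "bs \<in> pauli_labels d n"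
  shows "mat_trace (mat_adjoint (pauli d as) * pauli d bs) = (if as = bs then of_nat (d ^ n) else 0)"
  using assms
proof (induction n arbitrary: as bs)
  case 0
  then show ?case by (simp add: mat_trace_def)
next
  case (Suc n)
  obtain x xs where as: "as = x # xs" "x \<in> sites d" "xs \<in> pauli_labels d n"
    using Suc.prems(1) by (rule pauli_labels_SucE)
  obtain y ys where bs: "bs = y # ys" "y \<in> sites d" "ys \<in> pauli_labels d n"
    using Suc.prems(2) by (rule pauli_labels_SucE)
  have car: "pauli d xs \<in> carrier_mat (d ^ n) (d ^ n)" "pauli d ys \<in> carrier_mat (d ^ n) (d ^ n)"
    using as bs by auto
  have "mat_trace (mat_adjoint (pauli d as) * pauli d bs) =
      mat_trace (mat_adjoint (pauli1 d x) * pauli1 d y) * mat_trace (mat_adjoint (pauli d xs) * pauli d ys)"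
    unfolding as bs pauli_Cons kronecker_adjoint using car
    by (subst kronecker_mult[where m=d and k=d and m'="d^n" and k'="d^n" and l=d and l'="d^n"])
      (auto intro!: trace_kronecker mult_carrier_mat)
  also have "\<dots> = (if as = bs then of_nat (d ^ Suc n) else 0)"
    using as bs by (simp add: pauli1_orthogonal Suc.IH)
  finally show ?case .
qed

text \<open>Operators and entry indices both factor after splitting off the first site, so
  single-site completeness combines with the induction hypothesis.\<close>

lemma pauli_complete:
  assumes "i < d ^ n" "j < d ^ n" "k < d ^ n" "l < d ^ n"
  shows "(\<Sum>as\<in>pauli_labels d n. pauli d as $$ (i, j) * cnj (pauli d as $$ (k, l))) =
    (if i = k \<and> j = l then of_nat (d ^ n) else 0)"
  using assms
proof (induction n arbitrary: i j k l)
  case 0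
  then show ?case by simp
next
  case (Suc n)
  let ?N = "d ^ n"
  have lt: "i < d * ?N" "j < d * ?N" "k < d * ?N" "l < d * ?N" using Suc.prems by auto
  note dm = lt[THEN div_mod_less_product(1)] lt[THEN div_mod_less_product(2)]
  have "(\<Sum>as\<in>pauli_labels d (Suc n). pauli d as $$ (i, j) * cnj (pauli d as $$ (k, l))) =
     (\<Sum>x\<in>sites d. \<Sum>xs\<in>pauli_labels d n.
        (pauli1 d x $$ (i div ?N, j div ?N) * cnj (pauli1 d x $$ (k div ?N, l div ?N))) *
        (pauli d xs $$ (i mod ?N, j mod ?N) * cnj (pauli d xs $$ (k mod ?N, l mod ?N))))"
    unfolding sum_pauli_labels_Suc
  proof (intro sum.cong refl)
    fix x xs assume "xs \<in> pauli_labels d n"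
    then have "dim_row (pauli d xs) = ?N" "dim_col (pauli d xs) = ?N"
      using pauli_carrier by blast+
    then show "pauli d (x # xs) $$ (i, j) * cnj (pauli d (x # xs) $$ (k, l)) =
        (pauli1 d x $$ (i div ?N, j div ?N) * cnj (pauli1 d x $$ (k div ?N, l div ?N))) *
        (pauli d xs $$ (i mod ?N, j mod ?N) * cnj (pauli d xs $$ (k mod ?N, l mod ?N)))"
      using lt by (simp add: pauli_Cons index_kronecker)
  qed
  also have "\<dots> = (\<Sum>x\<in>sites d. pauli1 d x $$ (i div ?N, j div ?N) * cnj (pauli1 d x $$ (k div ?N, l div ?N))) *
      (\<Sum>xs\<in>pauli_labels d n. pauli d xs $$ (i mod ?N, j mod ?N) * cnj (pauli d xs $$ (k mod ?N, l mod ?N)))"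
    by (simp add: sum_product)
  also have "\<dots> = (if i div ?N = k div ?N \<and> j div ?N = l div ?N then of_nat d else 0) *
      (if i mod ?N = k mod ?N \<and> j mod ?N = l mod ?N then of_nat ?N else 0)"
    by (simp only: pauli1_complete[OF dm(1-4)] Suc.IH[OF dm(5-8)])
  also have "\<dots> = (if i = k \<and> j = l then of_nat (d ^ Suc n) else 0)"
    by auto (metis div_mult_mod_eq)+
  finally show ?case .
qed

lemma pauli_replicate_zero: "pauli d (replicate n (0, 0)) = 1\<^sub>m (d ^ n)"
proof (induction n)
  case (Suc n)
  have "kronecker (1\<^sub>m d) (1\<^sub>m (d ^ n)) = (1\<^sub>m (d * d ^ n) :: complex mat)"
  proof (rule eq_matI)
    fix i j assume "i < dim_row (1\<^sub>m (d * d ^ n) :: complex mat)" "j < dim_col (1\<^sub>m (d * d ^ n) :: complex mat)"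
    then have ij: "i < d * d ^ n" "j < d * d ^ n" by auto
    have "i = j \<longleftrightarrow> i div d ^ n = j div d ^ n \<and> i mod d ^ n = j mod d ^ n"
      by (metis div_mult_mod_eq)
    then show "kronecker (1\<^sub>m d) (1\<^sub>m (d ^ n)) $$ (i, j) = (1\<^sub>m (d * d ^ n) :: complex mat) $$ (i, j)"
      using ij ij[THEN div_mod_less_product(1)] ij[THEN div_mod_less_product(2)]
      by (simp add: index_kronecker)
  qed auto
  then show ?case by (simp add: pauli_Cons pauli1_zero Suc)
qed simp

lemma replicate_zero_in_pauli_labels [simp]: "d > 0 \<Longrightarrow> replicate n (0, 0) \<in> pauli_labels d n"
  by (auto simp: pauli_labels_def)

section \<open>Pauli weight and the labels of weight one\<close>

lemma pauli_weight_Nil [simp]: "pauli_weight [] = 0"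
  by (simp add: pauli_weight_def)

lemma pauli_weight_Cons: "pauli_weight (x # xs) = (if x = (0, 0) then 0 else 1) + pauli_weight xs"
proof -
  let ?S = "{j. j < length xs \<and> xs ! j \<noteq> (0, 0)}"
  have "{j. j < length (x # xs) \<and> (x # xs) ! j \<noteq> (0, 0)} = (if x = (0, 0) then {} else {0}) \<union> Suc ` ?S"
  proof (rule Set.set_eqI)
    fix j show "j \<in> {j. j < length (x # xs) \<and> (x # xs) ! j \<noteq> (0, 0)} \<longleftrightarrow>
      j \<in> (if x = (0, 0) then {} else {0}) \<union> Suc ` ?S"
      by (cases j) auto
  qed
  moreover have "card (Suc ` ?S) = card ?S" by (simp add: card_image)
  moreover have "card (insert 0 (Suc ` ?S)) = Suc (card (Suc ` ?S))"
    by (subst card_insert_disjoint) auto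
  ultimately show ?thesis by (auto simp: pauli_weight_def)
qed

lemma pauli_weight_eq_0_iff:
  "as \<in> pauli_labels d n \<Longrightarrow> pauli_weight as = 0 \<longleftrightarrow> as = replicate n (0, 0)"
proof (induction n arbitrary: as)
  case (Suc n)
  then show ?case by (auto elim!: pauli_labels_SucE simp: pauli_weight_Cons split: if_splits)
qed auto

definition weight_one_labels :: "nat \<Rightarrow> nat \<Rightarrow> (nat \<times> nat) list set" where
  "weight_one_labels d n = {as \<in> pauli_labels d n. pauli_weight as = 1}"

lemma finite_weight_one_labels [simp]: "finite (weight_one_labels d n)"
  by (simp add: weight_one_labels_def)

text \<open>The nontrivial entry either lies in the tail, or it is the head and the tail is trivial.
  This recursion carries the induction for the twirl.\<close>

lemma sum_weight_one_labels_Suc: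
  assumes "d > 0"
  shows "(\<Sum>as\<in>weight_one_labels d (Suc n). f as) =
    (\<Sum>as\<in>weight_one_labels d n. f ((0, 0) # as)) +
    (\<Sum>x\<in>sites d - {(0, 0)}. f (x # replicate n (0, 0)) :: 'b::comm_monoid_add)"
proof -
  have split: "weight_one_labels d (Suc n) = (#) (0, 0) ` weight_one_labels d n \<union>
      (\<lambda>x. x # replicate n (0, 0)) ` (sites d - {(0, 0)})"
  proof (intro equalityI subsetI)
    fix as assume "as \<in> weight_one_labels d (Suc n)"
    then obtain x xs where as: "as = x # xs" "x \<in> sites d" "xs \<in> pauli_labels d n" "pauli_weight as = 1"
      unfolding weight_one_labels_def by (auto elim!: pauli_labels_SucE)
    show "as \<in> (#) (0, 0) ` weight_one_labels d n \<union> (\<lambda>x. x # replicate n (0, 0)) ` (sites d - {(0, 0)})"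
    proof (cases "x = (0, 0)")
      case True
      with as show ?thesis by (auto simp: pauli_weight_Cons weight_one_labels_def)
    next
      case False
      with as have "pauli_weight xs = 0" by (auto simp: pauli_weight_Cons)
      with as have "xs = replicate n (0, 0)" by (simp add: pauli_weight_eq_0_iff)
      with as False show ?thesis by auto
    qed
  next
    fix as assume "as \<in> (#) (0, 0) ` weight_one_labels d n \<union> (\<lambda>x. x # replicate n (0, 0)) ` (sites d - {(0, 0)})"
    moreover have "replicate n (0, 0) \<in> pauli_labels d n" "pauli_weight (replicate n (0, 0)) = 0"
      using assms pauli_weight_eq_0_iff[of "replicate n (0, 0)" d n] by auto
    ultimately show "as \<in> weight_one_labels d (Suc n)"
      using assms by (auto simp: weight_one_labels_def Cons_in_pauli_labels pauli_weight_Cons split: if_splits)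
  qed
  show ?thesis
    unfolding split
    by (subst sum.union_disjoint) (auto simp: sum.reindex inj_on_def)
qed

subsection \<open>Twirling over weight-one Pauli operators\<close>

text \<open>By completeness, summing \<open>P B P^*\<close> over all single-site Pauli operators
  \<open>P\<close> gives \<open>d\<close> times the trace of \<open>B\<close> times the identity,
  and Pauli operators other than the identity are traceless. The value \<open>d ^ 3\<close> is
  \<open>d\<close> times two traces of the identity.\<close>

lemma pauli1_twirl:
  assumes "b \<in> sites d" "b' \<in> sites d"
  shows "(\<Sum>x\<in>sites d. mat_trace (mat_adjoint (pauli1 d b') * (pauli1 d x * pauli1 d b * mat_adjoint (pauli1 d x)))) =
    (if b = (0, 0) \<and> b' = (0, 0) then of_nat (d ^ 3) else 0)"
proof -
  have d: "d > 0" using assms by auto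
  then have tr: "mat_trace (pauli1 d c) = (if c = (0, 0) then of_nat d else 0)" if "c \<in> sites d" for c
    using pauli1_orthogonal[of "(0, 0)" d c] that by (auto simp: pauli1_zero left_mult_one_mat[of _ d d])
  have conj: "(pauli1 d x * pauli1 d b * mat_adjoint (pauli1 d x)) $$ (i, k) =
      (\<Sum>j<d. \<Sum>l<d. pauli1 d b $$ (j, l) * (pauli1 d x $$ (i, j) * cnj (pauli1 d x $$ (k, l))))"
    if "i < d" "k < d" for x i k
  proof -
    have "(pauli1 d x * pauli1 d b * mat_adjoint (pauli1 d x)) $$ (i, k) =
      (\<Sum>l<d. (\<Sum>j<d. pauli1 d x $$ (i, j) * pauli1 d b $$ (j, l)) * cnj (pauli1 d x $$ (k, l)))"
      using that by (simp add: scalar_prod_def lessThan_atLeast0)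
    also have "\<dots> = (\<Sum>l<d. \<Sum>j<d. pauli1 d b $$ (j, l) * (pauli1 d x $$ (i, j) * cnj (pauli1 d x $$ (k, l))))"
      by (simp add: sum_distrib_right mult.assoc mult.left_commute)
    finally show ?thesis by (subst sum.swap)
  qed
  have twirl: "(\<Sum>x\<in>sites d. (pauli1 d x * pauli1 d b * mat_adjoint (pauli1 d x)) $$ (i, k)) =
      (if i = k then of_nat d * mat_trace (pauli1 d b) else 0)" if "i < d" "k < d" for i k
  proof -
    have "(\<Sum>x\<in>sites d. (pauli1 d x * pauli1 d b * mat_adjoint (pauli1 d x)) $$ (i, k)) =
      (\<Sum>x\<in>sites d. \<Sum>j<d. \<Sum>l<d. pauli1 d b $$ (j, l) * (pauli1 d x $$ (i, j) * cnj (pauli1 d x $$ (k, l))))"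
      using that by (simp only: conj)
    also have "\<dots> = (\<Sum>j<d. \<Sum>l<d. \<Sum>x\<in>sites d. pauli1 d b $$ (j, l) * (pauli1 d x $$ (i, j) * cnj (pauli1 d x $$ (k, l))))"
      by (subst sum.swap, rule sum.cong[OF refl], rule sum.swap)
    also have "\<dots> = (\<Sum>j<d. \<Sum>l<d. pauli1 d b $$ (j, l) * (if i = k \<and> j = l then of_nat d else 0))"
      using that by (simp only: sum_distrib_left[symmetric])
        (intro sum.cong refl arg_cong2[where f="(*)"] pauli1_complete, auto)
    also have "\<dots> = (\<Sum>j<d. \<Sum>l<d. if l = j then (if i = k then of_nat d * pauli1 d b $$ (j, j) else 0) else 0)"
      by (intro sum.cong refl) auto
    also have "\<dots> = (if i = k then of_nat d * mat_trace (pauli1 d b) else 0)"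
      by (simp add: mat_trace_def sum_distrib_left)
    finally show ?thesis .
  qed
  have "(\<Sum>x\<in>sites d. mat_trace (mat_adjoint (pauli1 d b') * (pauli1 d x * pauli1 d b * mat_adjoint (pauli1 d x)))) =
      (\<Sum>x\<in>sites d. \<Sum>i<d. \<Sum>k<d. cnj (pauli1 d b' $$ (i, k)) * (pauli1 d x * pauli1 d b * mat_adjoint (pauli1 d x)) $$ (i, k))"
    by (intro sum.cong refl trace_adjoint_mult) (auto intro!: mult_carrier_mat[of _ d d])
  also have "\<dots> = (\<Sum>i<d. \<Sum>k<d. \<Sum>x\<in>sites d. cnj (pauli1 d b' $$ (i, k)) * (pauli1 d x * pauli1 d b * mat_adjoint (pauli1 d x)) $$ (i, k))"
    by (subst sum.swap, rule sum.cong[OF refl], rule sum.swap)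
  also have "\<dots> = (\<Sum>i<d. \<Sum>k<d. cnj (pauli1 d b' $$ (i, k)) * (if i = k then of_nat d * mat_trace (pauli1 d b) else 0))"
    by (simp only: sum_distrib_left[symmetric]) (intro sum.cong refl arg_cong2[where f="(*)"] twirl, auto)
  also have "\<dots> = (\<Sum>i<d. \<Sum>k<d. if k = i then cnj (pauli1 d b' $$ (i, i)) * (of_nat d * mat_trace (pauli1 d b)) else 0)"
    by (intro sum.cong refl) auto
  also have "\<dots> = cnj (mat_trace (pauli1 d b')) * (of_nat d * mat_trace (pauli1 d b))"
    by (simp add: mat_trace_def sum_distrib_right)
  also have "\<dots> = (if b = (0, 0) \<and> b' = (0, 0) then of_nat (d ^ 3) else 0)"
    using assms by (simp add: tr power3_eq_cube)
  finally show ?thesis .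
qed

text \<open>
  Each site with a trivial entry of \<open>bs\<close> contributes \<open>d\<^sup>2 - 1\<close> to the eigenvalue, every other site \<open>-1\<close>.
\<close>

lemma pauli_weight_one_twirl:
  assumes "d > 0" "bs \<in> pauli_labels d n" "bs' \<in> pauli_labels d n"
  shows "(\<Sum>as\<in>weight_one_labels d n.
      mat_trace (mat_adjoint (pauli d bs') * (pauli d as * pauli d bs * mat_adjoint (pauli d as)))) =
    (if bs = bs' then (of_nat (d\<^sup>2) * (of_nat n - of_nat (pauli_weight bs)) - of_nat n) * of_nat (d ^ n) else 0)"
  using assms(2,3)
proof (induction n arbitrary: bs bs')
  case 0
  then show ?case by (simp add: weight_one_labels_def)
next
  case (Suc n)
  let ?N = "d ^ n" and ?h = "\<lambda>A B C. mat_trace (mat_adjoint A * (B * C * mat_adjoint B))"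
  obtain y ys where bs: "bs = y # ys" "y \<in> sites d" "ys \<in> pauli_labels d n"
    using Suc.prems(1) by (rule pauli_labels_SucE)
  obtain y' ys' where bs': "bs' = y' # ys'" "y' \<in> sites d" "ys' \<in> pauli_labels d n"
    using Suc.prems(2) by (rule pauli_labels_SucE)
  have car: "pauli d ys \<in> carrier_mat ?N ?N" "pauli d ys' \<in> carrier_mat ?N ?N"
    using bs bs' by auto
  have zero: "replicate n (0, 0) \<in> pauli_labels d n" using assms(1) by simp
  have h_Cons: "?h (pauli d bs') (pauli d (x # xs)) (pauli d bs) =
      ?h (pauli1 d y') (pauli1 d x) (pauli1 d y) * ?h (pauli d ys') (pauli d xs) (pauli d ys)"
    if "xs \<in> pauli_labels d n" for x xs
  proof -
    have c: "pauli d xs \<in> carrier_mat ?N ?N" using that by simp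
    note m = kronecker_mult[where m=d and k=d and m'="?N" and k'="?N" and l=d and l'="?N"]
    show ?thesis
      unfolding bs(1) bs'(1) pauli_Cons kronecker_adjoint
      using c car by (simp add: m mult_carrier_mat[of _ d d] mult_carrier_mat[of _ ?N ?N]
        trace_kronecker[of _ d _ ?N])
  qed
  have h_one: "?h A (1\<^sub>m k) C = mat_trace (mat_adjoint A * C)" if "C \<in> carrier_mat k k" for A C k
    using that by (simp add: right_mult_one_mat[of _ k k] left_mult_one_mat[of _ k k])
  let ?R = "\<Sum>as\<in>weight_one_labels d n. ?h (pauli d ys') (pauli d as) (pauli d ys)"
  \<comment> \<open>The full twirl minus the identity term, which is a plain trace product.\<close>
  have sum_nonzero: "(\<Sum>x\<in>sites d - {(0, 0)}. ?h (pauli1 d y') (pauli1 d x) (pauli1 d y)) =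
      (if y = (0, 0) \<and> y' = (0, 0) then of_nat (d ^ 3) else 0) - (if y' = y then of_nat d else 0)"
    using assms(1) bs(2) bs'(2)
    by (subst sum_diff1) (simp_all only: pauli1_twirl, auto simp: pauli1_zero h_one pauli1_orthogonal)
  \<comment> \<open>The conjugating operator acts on the tail or on the first site; the factor on
    the other side is in each case a plain trace product.\<close>
  have "(\<Sum>as\<in>weight_one_labels d (Suc n). ?h (pauli d bs') (pauli d as) (pauli d bs)) =
    (\<Sum>as\<in>weight_one_labels d n. ?h (pauli1 d y') (pauli1 d (0, 0)) (pauli1 d y) * ?h (pauli d ys') (pauli d as) (pauli d ys)) +
    (\<Sum>x\<in>sites d - {(0, 0)}. ?h (pauli1 d y') (pauli1 d x) (pauli1 d y) *
       ?h (pauli d ys') (pauli d (replicate n (0, 0))) (pauli d ys))"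
    unfolding sum_weight_one_labels_Suc[OF assms(1)]
    by (intro arg_cong2[where f="(+)"] sum.cong refl h_Cons zero) (auto simp: weight_one_labels_def)
  also have "\<dots> = (if y' = y then of_nat d else 0) * ?R +
    ((if y = (0, 0) \<and> y' = (0, 0) then of_nat (d ^ 3) else 0) - (if y' = y then of_nat d else 0)) *
      (if ys' = ys then of_nat ?N else 0)"
    using bs bs' car
    by (simp only: sum_distrib_left[symmetric] sum_distrib_right[symmetric] sum_nonzero pauli1_zero
        pauli_replicate_zero h_one[OF pauli1_carrier] h_one[OF car(1)] pauli1_orthogonal pauli_orthogonal)
  also have "?R = (if ys = ys' then (of_nat (d\<^sup>2) * (of_nat n - of_nat (pauli_weight ys)) - of_nat n) * of_nat ?N else 0)"
    using bs bs' by (intro Suc.IH)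
  finally show ?case
    unfolding bs(1) bs'(1)
    by (auto simp: pauli_weight_Cons algebra_simps power2_eq_square power3_eq_cube)
qed

subsection \<open>Pauli expansions and the average weight\<close>

locale qudits =
  fixes d n :: nat
  assumes d_pos: "d > 0"
begin

abbreviation ops :: "complex mat set" where "ops \<equiv> carrier_mat (d ^ n) (d ^ n)"
abbreviation labels :: "(nat \<times> nat) list set" where "labels \<equiv> pauli_labels d n"
abbreviation ones :: "(nat \<times> nat) list set" where "ones \<equiv> weight_one_labels d n"
abbreviation ip :: "complex mat \<Rightarrow> complex mat \<Rightarrow> complex" where "ip \<equiv> op_inner d n"
abbreviation coef :: "complex mat \<Rightarrow> (nat \<times> nat) list \<Rightarrow> complex" where
  "coef A as \<equiv> op_inner d n (pauli d as) A"

lemma ops_closed [simp, intro]: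
  "A \<in> ops \<Longrightarrow> mat_adjoint A \<in> ops" "A \<in> ops \<Longrightarrow> B \<in> ops \<Longrightarrow> A * B \<in> ops"
  by auto

lemma ones_subset: "ones \<subseteq> labels"
  by (auto simp: weight_one_labels_def)

lemma in_ones_labels [dest]: "as \<in> ones \<Longrightarrow> as \<in> labels"
  by (auto simp: weight_one_labels_def)

lemma pauli_in_ops [simp]: "as \<in> labels \<Longrightarrow> pauli d as \<in> ops" "as \<in> ones \<Longrightarrow> pauli d as \<in> ops"
  by auto

section \<open>The normalized trace inner product\<close>

lemma ip_eq_sum:
  assumes "A \<in> ops" "B \<in> ops"
  shows "ip A B = 1 / of_nat (d ^ n) * (\<Sum>i<d ^ n. \<Sum>j<d ^ n. cnj (A $$ (i, j)) * B $$ (i, j))"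
  unfolding op_inner_def using assms by (simp only: trace_adjoint_mult)

lemma ip_commute: "A \<in> ops \<Longrightarrow> B \<in> ops \<Longrightarrow> cnj (ip A B) = ip B A"
  by (simp add: ip_eq_sum mult.commute)

text \<open>Cyclicity of the trace moves the outer factors to the other argument. A coefficient of a
  conjugated operator thereby becomes an inner product with a conjugated Pauli operator.\<close>

lemma ip_sandwich:
  assumes "X \<in> ops" "Y \<in> ops" "Z \<in> ops" "B \<in> ops"
  shows "ip X (Y * B * Z) = ip (mat_adjoint Y * X * mat_adjoint Z) B"
proof -
  let ?X = "mat_adjoint X"
  have "mat_trace (?X * (Y * B * Z)) = mat_trace ((?X * (Y * B)) * Z)"
    using assms by (simp add: assoc_mult_mat[of _ "d^n" "d^n" _ "d^n" _ "d^n"] mult_carrier_mat[of _ "d^n" "d^n"])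
  also have "\<dots> = mat_trace (Z * (?X * (Y * B)))"
    using assms by (intro trace_commute[of _ "d^n" "d^n"]) auto
  also have "Z * (?X * (Y * B)) = mat_adjoint (mat_adjoint Y * X * mat_adjoint Z) * B"
    using assms by (simp add: mat_adjoint_mult[of _ "d^n" "d^n" _ "d^n"]
        assoc_mult_mat[of _ "d^n" "d^n" _ "d^n" _ "d^n"] mult_carrier_mat[of _ "d^n" "d^n"])
  finally show ?thesis by (simp add: op_inner_def)
qed

lemma ip_pauli: "as \<in> labels \<Longrightarrow> bs \<in> labels \<Longrightarrow> ip (pauli d as) (pauli d bs) = (if as = bs then 1 else 0)"
  using d_pos by (simp add: op_inner_def pauli_orthogonal)

text \<open>Writing the coefficients out and exchanging sums exposes the completeness relation,
  which picks the entry \<open>(i, j)\<close> of \<open>A\<close>.\<close>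

lemma pauli_expansion:
  assumes "A \<in> ops" "i < d ^ n" "j < d ^ n"
  shows "(\<Sum>as\<in>labels. coef A as * pauli d as $$ (i, j)) = A $$ (i, j)"
proof -
  have "(\<Sum>as\<in>labels. coef A as * pauli d as $$ (i, j)) =
      1 / of_nat (d ^ n) * (\<Sum>as\<in>labels. \<Sum>k<d ^ n. \<Sum>l<d ^ n.
        A $$ (k, l) * (pauli d as $$ (i, j) * cnj (pauli d as $$ (k, l))))"
    using assms by (simp add: ip_eq_sum sum_distrib_left sum_distrib_right mult_ac)
  also have "\<dots> = 1 / of_nat (d ^ n) * (\<Sum>k<d ^ n. \<Sum>l<d ^ n. \<Sum>as\<in>labels.
        A $$ (k, l) * (pauli d as $$ (i, j) * cnj (pauli d as $$ (k, l))))"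
    by (subst sum.swap, subst sum.swap[where A=labels], rule refl)
  also have "\<dots> = 1 / of_nat (d ^ n) * (\<Sum>k<d ^ n. \<Sum>l<d ^ n.
        A $$ (k, l) * (if i = k \<and> j = l then of_nat (d ^ n) else 0))"
    using assms by (simp only: sum_distrib_left[symmetric])
      (intro sum.cong refl arg_cong2[where f="(*)"] pauli_complete, auto)
  also have "\<dots> = 1 / of_nat (d ^ n) * (\<Sum>k<d ^ n. if k = i then A $$ (i, j) * of_nat (d ^ n) else 0)"
  proof (intro arg_cong2[where f="(*)"] sum.cong refl)
    fix k
    have "(\<Sum>l<d ^ n. A $$ (k, l) * (if i = k \<and> j = l then of_nat (d ^ n) else 0)) =
        (\<Sum>l<d ^ n. if l = j then (if k = i then A $$ (i, j) * of_nat (d ^ n) else 0) else 0)"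
      by (intro sum.cong refl) auto
    then show "(\<Sum>l<d ^ n. A $$ (k, l) * (if i = k \<and> j = l then of_nat (d ^ n) else 0)) =
        (if k = i then A $$ (i, j) * of_nat (d ^ n) else 0)"
      using assms by simp
  qed
  also have "\<dots> = A $$ (i, j)" using assms d_pos by simp
  finally show ?thesis .
qed

text \<open>The body copies the expansion inside \<open>pauli_coeffs\<close>, so that the definite
  description there folds into a statement about \<open>lincomb\<close>.\<close>

definition lincomb :: "((nat \<times> nat) list \<Rightarrow> complex) \<Rightarrow> complex mat" where
  "lincomb c = mat (d ^ n) (d ^ n) (\<lambda>(i, j). \<Sum>as\<in>labels. c as * pauli d as $$ (i, j))"

lemma lincomb_in_ops [simp]: "lincomb c \<in> ops"
  by (simp add: lincomb_def)

lemma lincomb_coef: "A \<in> ops \<Longrightarrow> lincomb (coef A) = A"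
  by (rule eq_matI) (auto simp: lincomb_def pauli_expansion)

lemma ip_lincomb:
  assumes "A \<in> ops"
  shows "ip A (lincomb c) = (\<Sum>as\<in>labels. c as * ip A (pauli d as))"
proof -
  have "ip A (lincomb c) = 1 / of_nat (d ^ n) * (\<Sum>i<d ^ n. \<Sum>j<d ^ n. \<Sum>as\<in>labels.
      c as * (cnj (A $$ (i, j)) * pauli d as $$ (i, j)))"
    using assms by (simp add: ip_eq_sum) (simp add: lincomb_def sum_distrib_left mult_ac)
  also have "\<dots> = 1 / of_nat (d ^ n) * (\<Sum>as\<in>labels. \<Sum>i<d ^ n. \<Sum>j<d ^ n.
      c as * (cnj (A $$ (i, j)) * pauli d as $$ (i, j)))"
    by (subst sum.swap[where B=labels], subst sum.swap[where B=labels], rule refl)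
  also have "\<dots> = (\<Sum>as\<in>labels. c as * ip A (pauli d as))"
    using assms by (simp add: ip_eq_sum sum_distrib_left mult_ac)
  finally show ?thesis .
qed

lemma coef_lincomb: "bs \<in> labels \<Longrightarrow> coef (lincomb c) bs = c bs"
  by (simp add: ip_lincomb ip_pauli if_distrib[of "\<lambda>x. _ * x"] cong: if_cong)

lemma parseval:
  assumes "A \<in> ops" "B \<in> ops"
  shows "ip A B = (\<Sum>as\<in>labels. cnj (coef A as) * coef B as)"
proof -
  have "ip A B = (\<Sum>as\<in>labels. coef B as * ip A (pauli d as))"
    using assms by (metis ip_lincomb lincomb_coef)
  also have "\<dots> = (\<Sum>as\<in>labels. cnj (coef A as) * coef B as)"
    using assms by (intro sum.cong refl) (simp add: ip_commute)
  finally show ?thesis .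
qed

lemma ip_self: "A \<in> ops \<Longrightarrow> ip A A = of_real (\<Sum>as\<in>labels. (cmod (coef A as))\<^sup>2)"
  unfolding of_real_sum complex_norm_square mult.commute[of _ "cnj _"] by (rule parseval)

text \<open>Existence comes from completeness and uniqueness from orthonormality; restricting to
  \<open>labels\<close> supplies the extensionality that the description demands.\<close>

lemma pauli_coeffs_eq:
  assumes "A \<in> ops" "as \<in> labels"
  shows "pauli_coeffs d n A as = coef A as"
proof -
  let ?c = "restrict (coef A) labels"
  have "pauli_coeffs d n A = ?c"
    unfolding pauli_coeffs_def lincomb_def[symmetric]
  proof (rule the_equality)
    have "lincomb ?c = lincomb (coef A)"
      unfolding lincomb_def by (intro cong_mat refl) (auto intro!: sum.cong)
    then show "?c \<in> extensional labels \<and> A = lincomb ?c"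
      using assms by (simp add: lincomb_coef)
  next
    fix c assume "c \<in> extensional labels \<and> A = lincomb c"
    then show "c = ?c" by (intro extensionalityI[of _ labels]) (auto simp: coef_lincomb)
  qed
  then show ?thesis using assms by simp
qed

lemma avg_weight_eq:
  "A \<in> ops \<Longrightarrow> avg_weight d n A = (\<Sum>as\<in>labels. real (pauli_weight as) * (cmod (coef A as))\<^sup>2)"
  by (simp add: avg_weight_def pauli_coeffs_eq)

lemma op_norm2_eq_1_iff:
  "A \<in> ops \<Longrightarrow> op_norm2 d n A = 1 \<longleftrightarrow> (\<Sum>as\<in>labels. (cmod (coef A as))\<^sup>2) = 1"
  by (simp add: op_norm2_def ip_self)

text \<open>The all-zero label is the only one of weight 0 and its operator is the identity, so its
  coefficient is the normalized trace.\<close>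

lemma trace_eq_0_iff:
  assumes "A \<in> ops"
  shows "mat_trace A = 0 \<longleftrightarrow> (\<forall>as\<in>labels. pauli_weight as = 0 \<longrightarrow> coef A as = 0)"
proof -
  have "coef A (replicate n (0, 0)) = mat_trace A / of_nat (d ^ n)"
    using assms by (simp add: op_inner_def pauli_replicate_zero left_mult_one_mat[of _ "d^n" "d^n"])
  then have "mat_trace A = 0 \<longleftrightarrow> coef A (replicate n (0, 0)) = 0"
    using d_pos by simp
  then show ?thesis using d_pos pauli_weight_eq_0_iff by auto
qed

text \<open>The constraints of \<open>growth_values\<close> without the weight condition. They are
  kept apart because every unitary conjugation preserves them, while it may change the
  weight.\<close>

definition unit_traceless :: "complex mat \<Rightarrow> bool" where
  "unit_traceless A \<longleftrightarrow> A \<in> ops \<and> op_norm2 d n A = 1 \<and> mat_trace A = 0"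

text \<open>The norm condition lets 1 be subtracted inside the sum. The subtraction on naturals
  truncates only at weight 0, where tracelessness makes the coefficient vanish.\<close>

lemma avg_weight_excess:
  assumes "unit_traceless A"
  shows "avg_weight d n A - 1 = (\<Sum>as\<in>labels. real (pauli_weight as - 1) * (cmod (coef A as))\<^sup>2)"
proof -
  have A: "A \<in> ops" "(\<Sum>as\<in>labels. (cmod (coef A as))\<^sup>2) = 1"
    and 0: "\<And>as. as \<in> labels \<Longrightarrow> pauli_weight as = 0 \<Longrightarrow> coef A as = 0"
    using assms by (auto simp: unit_traceless_def op_norm2_eq_1_iff trace_eq_0_iff)
  have "avg_weight d n A - 1 =
      (\<Sum>as\<in>labels. real (pauli_weight as) * (cmod (coef A as))\<^sup>2 - (cmod (coef A as))\<^sup>2)"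
    using A by (simp add: avg_weight_eq sum_subtractf)
  also have "\<dots> = (\<Sum>as\<in>labels. real (pauli_weight as - 1) * (cmod (coef A as))\<^sup>2)"
  proof (rule sum.cong[OF refl])
    fix as assume "as \<in> labels"
    then show "real (pauli_weight as) * (cmod (coef A as))\<^sup>2 - (cmod (coef A as))\<^sup>2 =
        real (pauli_weight as - 1) * (cmod (coef A as))\<^sup>2"
      using 0[of as] by (cases "pauli_weight as") (auto simp: algebra_simps)
  qed
  finally show ?thesis .
qed

lemma avg_weight_ge_1: "unit_traceless A \<Longrightarrow> avg_weight d n A \<ge> 1"
  using avg_weight_excess[of A] sum_nonneg[of labels "\<lambda>as. real (pauli_weight as - 1) * (cmod (coef A as))\<^sup>2"]
  by simp

text \<open>The excess is a sum of nonnegative terms, so it vanishes exactly when no coefficient of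
  weight at least 2 survives; weight 0 is excluded by the trace.\<close>

lemma avg_weight_eq_1_iff:
  assumes "unit_traceless A"
  shows "avg_weight d n A = 1 \<longleftrightarrow> (\<forall>as\<in>labels - ones. coef A as = 0)"
proof -
  have 0: "\<And>as. as \<in> labels \<Longrightarrow> pauli_weight as = 0 \<Longrightarrow> coef A as = 0"
    using assms by (auto simp: unit_traceless_def trace_eq_0_iff)
  have "avg_weight d n A = 1 \<longleftrightarrow> (\<Sum>as\<in>labels. real (pauli_weight as - 1) * (cmod (coef A as))\<^sup>2) = 0"
    using avg_weight_excess[OF assms] by linarith
  also have "\<dots> \<longleftrightarrow> (\<forall>as\<in>labels. pauli_weight as \<le> 1 \<or> coef A as = 0)"
    by (subst sum_nonneg_eq_0_iff) auto
  also have "\<dots> \<longleftrightarrow> (\<forall>as\<in>labels - ones. coef A as = 0)"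
    using 0 by (auto simp: weight_one_labels_def le_Suc_eq)
  finally show ?thesis .
qed

lemma unit_traceless_pauli: "as \<in> ones \<Longrightarrow> unit_traceless (pauli d as)"
  unfolding unit_traceless_def
  by (auto simp: op_norm2_def ip_pauli trace_eq_0_iff weight_one_labels_def)

section \<open>Conjugation by unitaries\<close>

lemma is_unitary_iff:
  "is_unitary d n U \<longleftrightarrow> U \<in> ops \<and> mat_adjoint U * U = 1\<^sub>m (d ^ n) \<and> U * mat_adjoint U = 1\<^sub>m (d ^ n)"
  by (simp add: is_unitary_def n_qudit_ops_def)

lemma unitary_in_ops: "is_unitary d n U \<Longrightarrow> U \<in> ops"
  by (simp add: is_unitary_iff)

lemma is_unitary_adjoint: "is_unitary d n U \<Longrightarrow> is_unitary d n (mat_adjoint U)"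
  by (auto simp: is_unitary_iff)

lemma mult_assoc:
  "A \<in> ops \<Longrightarrow> B \<in> ops \<Longrightarrow> C \<in> ops \<Longrightarrow> A * B * C = A * (B * C)"
  by (rule assoc_mult_mat)

lemma unitary_cancel:
  assumes "is_unitary d n U" "A \<in> ops"
  shows "mat_adjoint U * (U * A) = A" "U * (mat_adjoint U * A) = A"
  using assms by (simp_all add: is_unitary_iff mult_assoc[symmetric] left_mult_one_mat[of _ "d^n" "d^n"])

lemma unitary_conj_cancel:
  assumes "is_unitary d n U" "A \<in> ops"
  shows "mat_adjoint U * (U * A * mat_adjoint U) * U = A"
    "U * (mat_adjoint U * A * U) * mat_adjoint U = A"
  using assms unitary_in_ops[OF assms(1)]
  by (simp_all add: mult_assoc unitary_cancel)
    (simp_all add: is_unitary_iff right_mult_one_mat[of _ "d^n" "d^n"])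

lemma ip_unitary_conj:
  assumes "is_unitary d n U" "A \<in> ops" "B \<in> ops"
  shows "ip (mat_adjoint U * A * U) (mat_adjoint U * B * U) = ip A B"
  using assms unitary_in_ops[OF assms(1)]
  by (simp add: ip_sandwich unitary_conj_cancel)

lemma unit_traceless_conj:
  assumes "is_unitary d n U" "unit_traceless A"
  shows "unit_traceless (mat_adjoint U * A * U)"
proof -
  have c: "U \<in> ops" "A \<in> ops" using assms by (auto simp: unitary_in_ops unit_traceless_def)
  have "mat_trace (mat_adjoint U * A * U) = mat_trace (U * (mat_adjoint U * A))"
    using c by (intro trace_commute[of _ "d^n" "d^n"]) auto
  then show ?thesis
    using assms c by (simp add: unit_traceless_def op_norm2_def ip_unitary_conj unitary_cancel)
qed

text \<open>Gives the matrix of conjugation in the Pauli basis. \<open>U\<close> is an arbitrary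
  operator, since later uses include conjugation by a general \<open>A\<close>.\<close>

lemma coef_conj:
  assumes "U \<in> ops" "A \<in> ops" "bs \<in> labels"
  shows "coef (mat_adjoint U * A * U) bs =
    (\<Sum>as\<in>labels. coef (mat_adjoint U * pauli d as * U) bs * coef A as)"
proof -
  let ?Q = "U * pauli d bs * mat_adjoint U"
  have "coef (mat_adjoint U * A * U) bs = ip ?Q A"
    using assms by (simp add: ip_sandwich)
  also have "\<dots> = (\<Sum>as\<in>labels. cnj (coef ?Q as) * coef A as)"
    using assms by (intro parseval) auto
  also have "\<dots> = (\<Sum>as\<in>labels. coef (mat_adjoint U * pauli d as * U) bs * coef A as)"
    using assms by (intro sum.cong refl) (simp add: ip_commute ip_sandwich)
  finally show ?thesis .
qed

lemma avg_weight_conj: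
  assumes "U \<in> ops" "A \<in> ops"
  shows "avg_weight d n (mat_adjoint U * A * U) = (\<Sum>bs\<in>labels. real (pauli_weight bs) *
    (cmod (\<Sum>as\<in>labels. coef (mat_adjoint U * pauli d as * U) bs * coef A as))\<^sup>2)"
proof -
  have "avg_weight d n (mat_adjoint U * A * U) =
      (\<Sum>bs\<in>labels. real (pauli_weight bs) * (cmod (coef (mat_adjoint U * A * U) bs))\<^sup>2)"
    using assms by (intro avg_weight_eq) auto
  also have "\<dots> = (\<Sum>bs\<in>labels. real (pauli_weight bs) *
    (cmod (\<Sum>as\<in>labels. coef (mat_adjoint U * pauli d as * U) bs * coef A as))\<^sup>2)"
    using assms by (intro sum.cong refl arg_cong2[where f="(*)"] arg_cong[where f="\<lambda>z. (cmod z)\<^sup>2"] coef_conj)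
  finally show ?thesis .
qed

subsection \<open>Non-entangling unitaries\<close>

text \<open>Conjugated weight-one Pauli operators stay traceless of norm one, so
  \<open>avg_weight_eq_1_iff\<close> turns the definition into the vanishing of a block of the
  conjugation matrix.\<close>

lemma non_entangling_iff:
  assumes "is_unitary d n U"
  shows "non_entangling d n U \<longleftrightarrow>
    (\<forall>as\<in>ones. \<forall>bs\<in>labels - ones. coef (mat_adjoint U * pauli d as * U) bs = 0)"
proof -
  have "non_entangling d n U \<longleftrightarrow> (\<forall>as\<in>ones. avg_weight d n (mat_adjoint U * pauli d as * U) = 1)"
    using assms by (auto simp: non_entangling_def weight_one_labels_def)
  also have "\<dots> \<longleftrightarrow> (\<forall>as\<in>ones. \<forall>bs\<in>labels - ones. coef (mat_adjoint U * pauli d as * U) bs = 0)"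
    using assms by (intro ball_cong refl avg_weight_eq_1_iff unit_traceless_conj unit_traceless_pauli)
  finally show ?thesis .
qed

lemma non_entangling_unitary: "non_entangling d n U \<Longrightarrow> is_unitary d n U"
  by (simp add: non_entangling_def)

text \<open>The two conjugations are adjoint to each other, so their matrices are conjugate
  transposes. This turns column sums for \<open>U\<close> into row sums for
  \<open>mat_adjoint U\<close>.\<close>

lemma coef_adjoint_conj:
  assumes "U \<in> ops" "as \<in> labels" "bs \<in> labels"
  shows "coef (U * pauli d bs * mat_adjoint U) as = cnj (coef (mat_adjoint U * pauli d as * U) bs)"
  using assms by (simp add: ip_commute ip_sandwich)

lemma sum_coef_unitary_conj:
  assumes "is_unitary d n U" "as \<in> labels"
  shows "(\<Sum>bs\<in>labels. (cmod (coef (mat_adjoint U * pauli d as * U) bs))\<^sup>2) = 1"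
proof -
  have "of_real (\<Sum>bs\<in>labels. (cmod (coef (mat_adjoint U * pauli d as * U) bs))\<^sup>2) =
      ip (mat_adjoint U * pauli d as * U) (mat_adjoint U * pauli d as * U)"
    using assms unitary_in_ops[OF assms(1)] by (intro ip_self[symmetric]) auto
  also have "\<dots> = ip (pauli d as) (pauli d as)"
    using assms by (intro ip_unitary_conj) auto
  also have "\<dots> = of_real 1" using assms by (simp add: ip_pauli)
  finally show ?thesis by (simp only: of_real_eq_iff)
qed

lemma sum_labels_ones:
  assumes "\<And>as. as \<in> labels - ones \<Longrightarrow> f as = 0"
  shows "(\<Sum>as\<in>labels. f as) = (\<Sum>as\<in>ones. f as :: 'b::comm_monoid_add)"
  using assms ones_subset by (intro sum.mono_neutral_right) auto

text \<open>
  The squared moduli of the matrix of \<open>A \<mapsto> U\<^sup>*AU\<close> have row sums \<open>1\<close> within the weight-one block and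
  column sums at most \<open>1\<close> there; the block being square, all of these are equal to \<open>1\<close>, so
  the block below it vanishes as well.
\<close>

lemma non_entangling_adjoint:
  assumes "non_entangling d n U"
  shows "non_entangling d n (mat_adjoint U)"
proof -
  have U: "is_unitary d n U" using assms by (rule non_entangling_unitary)
  define t where "t as bs = (cmod (coef (mat_adjoint U * pauli d as * U) bs))\<^sup>2" for as bs
  have row: "(\<Sum>bs\<in>ones. t as bs) = 1" if "as \<in> ones" for as
  proof -
    have "(\<Sum>bs\<in>labels. t as bs) = 1"
      unfolding t_def using that U by (intro sum_coef_unitary_conj) auto
    moreover have "(\<Sum>bs\<in>labels. t as bs) = (\<Sum>bs\<in>ones. t as bs)"
      using assms that by (intro sum_labels_ones) (auto simp: non_entangling_iff[OF U] t_def)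
    ultimately show ?thesis by simp
  qed
  have t_eq: "t as bs = (cmod (coef (U * pauli d bs * mat_adjoint U) as))\<^sup>2"
    if "as \<in> labels" "bs \<in> labels" for as bs
    using coef_adjoint_conj[OF unitary_in_ops[OF U] that] by (simp add: t_def)
  have col: "(\<Sum>as\<in>labels. t as bs) = 1" if "bs \<in> labels" for bs
  proof -
    have "(\<Sum>as\<in>labels. t as bs) = (\<Sum>as\<in>labels. (cmod (coef (U * pauli d bs * mat_adjoint U) as))\<^sup>2)"
      using that by (intro sum.cong refl t_eq)
    then show ?thesis
      using sum_coef_unitary_conj[OF is_unitary_adjoint[OF U] that] by simp
  qed
  have decomp: "(\<Sum>as\<in>labels. t as bs) = (\<Sum>as\<in>labels - ones. t as bs) + (\<Sum>as\<in>ones. t as bs)" for bs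
    using ones_subset by (intro sum.subset_diff) auto
  have "(\<Sum>bs\<in>ones. \<Sum>as\<in>labels - ones. t as bs) = (\<Sum>bs\<in>ones. 1 - (\<Sum>as\<in>ones. t as bs))"
    using col decomp by (intro sum.cong refl) (metis add_diff_cancel_right' in_ones_labels)
  also have "\<dots> = real (card ones) - (\<Sum>as\<in>ones. \<Sum>bs\<in>ones. t as bs)"
    by (subst sum.swap) (simp add: sum_subtractf)
  also have "\<dots> = 0" by (simp add: row)
  finally have "\<forall>bs\<in>ones. (\<Sum>as\<in>labels - ones. t as bs) = 0"
    by (subst (asm) sum_nonneg_eq_0_iff) (auto simp: t_def intro!: sum_nonneg)
  then have "\<forall>bs\<in>ones. \<forall>as\<in>labels - ones. t as bs = 0"
    by (subst (asm) sum_nonneg_eq_0_iff) (auto simp: t_def)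
  then show ?thesis
    unfolding non_entangling_iff[OF is_unitary_adjoint[OF U]] mat_adjoint_adjoint
    using t_eq by fastforce
qed

text \<open>The trace of the map \<open>X -> A^* X A\<close> compressed to the weight-one span,
  computed in the Pauli basis.\<close>

definition weight_one_trace :: "complex mat \<Rightarrow> complex" where
  "weight_one_trace A = (\<Sum>as\<in>ones. coef (mat_adjoint A * pauli d as * A) as)"

text \<open>By cyclicity each summand is the inner product of \<open>A\<close> with
  \<open>P A P^*\<close>. The sum over \<open>P\<close> is the weight-one twirl, whose eigenvalues
  are affine in the Pauli weight, so the trace encodes the average weight.\<close>

lemma weight_one_trace_eq:
  assumes "A \<in> ops"
  shows "weight_one_trace A =
    of_real (real (d\<^sup>2) * (real n * (\<Sum>as\<in>labels. (cmod (coef A as))\<^sup>2) - avg_weight d n A) -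
      real n * (\<Sum>as\<in>labels. (cmod (coef A as))\<^sup>2))"
proof -
  let ?w = "\<lambda>bs. of_nat (d\<^sup>2) * (of_nat n - of_nat (pauli_weight bs)) - of_nat n :: complex"
  have "weight_one_trace A = (\<Sum>as\<in>ones. \<Sum>bs\<in>labels. \<Sum>cs\<in>labels. cnj (coef A bs) *
      (coef (pauli d as * pauli d cs * mat_adjoint (pauli d as)) bs * coef A cs))"
    unfolding weight_one_trace_def
  proof (intro sum.cong refl)
    fix as assume "as \<in> ones"
    then have P: "pauli d as \<in> ops" "mat_adjoint (pauli d as) \<in> ops" by auto
    let ?P = "pauli d as"
    have "mat_trace (mat_adjoint ?P * (mat_adjoint A * ?P * A)) = mat_trace ((mat_adjoint A * ?P * A) * mat_adjoint ?P)"
      using P assms by (intro trace_commute[of _ "d^n" "d^n"]) auto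
    also have "(mat_adjoint A * ?P * A) * mat_adjoint ?P = mat_adjoint A * (?P * A * mat_adjoint ?P)"
      using P assms by (simp add: mult_assoc)
    finally have "coef (mat_adjoint A * ?P * A) as = ip A (?P * A * mat_adjoint ?P)"
      by (simp add: op_inner_def)
    also have "\<dots> = (\<Sum>bs\<in>labels. cnj (coef A bs) * coef (?P * A * mat_adjoint ?P) bs)"
      using P assms by (intro parseval) auto
    \<comment> \<open>\<open>coef_conj\<close> puts the adjoint on the left, so it is applied to the
      adjoint of \<open>?P\<close>.\<close>
    also have "\<dots> = (\<Sum>bs\<in>labels. cnj (coef A bs) * (\<Sum>cs\<in>labels. coef (?P * pauli d cs * mat_adjoint ?P) bs * coef A cs))"
      using coef_conj[OF P(2) assms] by (intro sum.cong refl arg_cong2[where f="(*)"]) simp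
    finally show "coef (mat_adjoint A * ?P * A) as =
        (\<Sum>bs\<in>labels. \<Sum>cs\<in>labels. cnj (coef A bs) * (coef (?P * pauli d cs * mat_adjoint ?P) bs * coef A cs))"
      by (simp add: sum_distrib_left)
  qed
  also have "\<dots> = (\<Sum>bs\<in>labels. \<Sum>cs\<in>labels. \<Sum>as\<in>ones. cnj (coef A bs) *
      (coef (pauli d as * pauli d cs * mat_adjoint (pauli d as)) bs * coef A cs))"
    by (subst sum.swap, rule sum.cong[OF refl], rule sum.swap)
  \<comment> \<open>The twirl is diagonal in the Pauli basis, which removes the cross terms.\<close>
  also have "\<dots> = (\<Sum>bs\<in>labels. \<Sum>cs\<in>labels. if cs = bs then coef A bs * cnj (coef A bs) * ?w bs else 0)"
  proof (intro sum.cong refl)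
    fix bs cs assume bc: "bs \<in> labels" "cs \<in> labels"
    have "(\<Sum>as\<in>ones. cnj (coef A bs) * (coef (pauli d as * pauli d cs * mat_adjoint (pauli d as)) bs * coef A cs)) =
      cnj (coef A bs) * coef A cs * (1 / of_nat (d ^ n)) *
      (\<Sum>as\<in>ones. mat_trace (mat_adjoint (pauli d bs) * (pauli d as * pauli d cs * mat_adjoint (pauli d as))))"
      unfolding sum_distrib_left by (intro sum.cong refl) (simp add: op_inner_def mult_ac)
    also have "\<dots> = (if cs = bs then coef A bs * cnj (coef A bs) * ?w bs else 0)"
      unfolding pauli_weight_one_twirl[OF d_pos bc(2,1)] using d_pos by simp
    finally show "(\<Sum>as\<in>ones. cnj (coef A bs) * (coef (pauli d as * pauli d cs * mat_adjoint (pauli d as)) bs * coef A cs)) =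
      (if cs = bs then coef A bs * cnj (coef A bs) * ?w bs else 0)" .
  qed
  also have "\<dots> = (\<Sum>bs\<in>labels. coef A bs * cnj (coef A bs) * ?w bs)"
    by (intro sum.cong refl) simp
  also have "\<dots> = (\<Sum>bs\<in>labels. of_real ((cmod (coef A bs))\<^sup>2 * (real (d\<^sup>2) * (real n - real (pauli_weight bs)) - real n)))"
    by (intro sum.cong refl) (simp only: of_real_mult complex_norm_square, simp)
  also have "\<dots> = of_real (real (d\<^sup>2) * (real n * (\<Sum>as\<in>labels. (cmod (coef A as))\<^sup>2) - avg_weight d n A) -
      real n * (\<Sum>as\<in>labels. (cmod (coef A as))\<^sup>2))"
    unfolding of_real_sum[symmetric] avg_weight_eq[OF assms]
    by (intro arg_cong[where f=of_real]) (simp add: sum_distrib_left sum_subtractf[symmetric] algebra_simps)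
  finally show ?thesis .
qed

text \<open>Inverse conjugation also preserves the weight-one span, so Parseval loses nothing when
  truncated to \<open>ones\<close>: the weight-one block has orthonormal columns.\<close>

lemma sum_ones_non_entangling:
  assumes "non_entangling d n U" "bs \<in> ones" "cs \<in> ones"
  shows "(\<Sum>as\<in>ones. cnj (coef (mat_adjoint U * pauli d as * U) bs) * coef (mat_adjoint U * pauli d as * U) cs) =
    (if bs = cs then 1 else 0)"
proof -
  let ?R = "\<lambda>bs. U * pauli d bs * mat_adjoint U"
  have U: "is_unitary d n U" using assms(1) by (rule non_entangling_unitary)
  have Uo: "U \<in> ops" using U by (rule unitary_in_ops)
  have zero: "coef (?R bs) as = 0" if "as \<in> labels - ones" for as
    using non_entangling_adjoint[OF assms(1)] that assms(2)
    unfolding non_entangling_iff[OF is_unitary_adjoint[OF U]] by simp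
  have "(\<Sum>as\<in>ones. cnj (coef (mat_adjoint U * pauli d as * U) bs) * coef (mat_adjoint U * pauli d as * U) cs) =
      (\<Sum>as\<in>ones. cnj (coef (?R cs) as) * coef (?R bs) as)"
    using assms coef_adjoint_conj[OF Uo] by (intro sum.cong refl) (simp add: in_ones_labels mult.commute)
  also have "\<dots> = (\<Sum>as\<in>labels. cnj (coef (?R cs) as) * coef (?R bs) as)"
    using zero by (intro sum_labels_ones[symmetric]) simp
  also have "\<dots> = ip (?R cs) (?R bs)"
    using Uo assms by (intro parseval[symmetric]) auto
  also have "\<dots> = ip (pauli d cs) (pauli d bs)"
    using ip_unitary_conj[OF is_unitary_adjoint[OF U], of "pauli d cs" "pauli d bs"] assms by simp
  finally show ?thesis using assms by (auto simp: ip_pauli in_ones_labels)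
qed

text \<open>Replacing \<open>A\<close> by its conjugate amounts to computing the same trace in the
  orthonormal basis \<open>?Q as\<close> of the weight-one span. Both copies of \<open>?Q as\<close>
  are expanded in Pauli operators, and orthonormality of the columns collapses the sums.\<close>

lemma weight_one_trace_non_entangling:
  assumes "non_entangling d n U" "A \<in> ops"
  shows "weight_one_trace (U * A * mat_adjoint U) = weight_one_trace A"
proof -
  have U: "is_unitary d n U" using assms(1) by (rule non_entangling_unitary)
  have Uo: "U \<in> ops" using U by (rule unitary_in_ops)
  let ?Q = "\<lambda>as. mat_adjoint U * pauli d as * U"
  have "weight_one_trace (U * A * mat_adjoint U) =
      (\<Sum>as\<in>ones. \<Sum>bs\<in>ones. \<Sum>cs\<in>ones.
        coef (mat_adjoint A * pauli d cs * A) bs * (cnj (coef (?Q as) bs) * coef (?Q as) cs))"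
    unfolding weight_one_trace_def
  proof (intro sum.cong refl)
    fix as assume as: "as \<in> ones"
    then have c: "pauli d as \<in> ops" "?Q as \<in> ops" using Uo by auto
    have zero: "coef (?Q as) bs = 0" if "bs \<in> labels - ones" for bs
      using assms(1) as that unfolding non_entangling_iff[OF U] by simp
    \<comment> \<open>Regrouping makes conjugation by \<open>A\<close> act on \<open>?Q as\<close>;
      the outer factors then move across the inner product.\<close>
    have "mat_adjoint (U * A * mat_adjoint U) * pauli d as * (U * A * mat_adjoint U) =
        U * (mat_adjoint A * ?Q as * A) * mat_adjoint U"
      using Uo assms(2) c(1) by (simp add: mult_assoc mat_adjoint_mult[of _ "d^n" "d^n" _ "d^n"])
    then have "coef (mat_adjoint (U * A * mat_adjoint U) * pauli d as * (U * A * mat_adjoint U)) as =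
        ip (?Q as) (mat_adjoint A * ?Q as * A)"
      using Uo assms(2) c by (simp only:) (subst ip_sandwich, auto)
    also have "\<dots> = (\<Sum>bs\<in>labels. cnj (coef (?Q as) bs) * coef (mat_adjoint A * ?Q as * A) bs)"
      using c assms(2) by (intro parseval) auto
    also have "\<dots> = (\<Sum>bs\<in>ones. cnj (coef (?Q as) bs) * coef (mat_adjoint A * ?Q as * A) bs)"
      using zero by (intro sum_labels_ones) simp
    also have "\<dots> = (\<Sum>bs\<in>ones. cnj (coef (?Q as) bs) * (\<Sum>cs\<in>labels. coef (mat_adjoint A * pauli d cs * A) bs * coef (?Q as) cs))"
      using c assms(2) by (intro sum.cong refl arg_cong2[where f="(*)"] coef_conj) auto
    also have "\<dots> = (\<Sum>bs\<in>ones. cnj (coef (?Q as) bs) * (\<Sum>cs\<in>ones. coef (mat_adjoint A * pauli d cs * A) bs * coef (?Q as) cs))"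
      using zero by (intro sum.cong refl arg_cong2[where f="(*)"] sum_labels_ones) simp
    finally show "coef (mat_adjoint (U * A * mat_adjoint U) * pauli d as * (U * A * mat_adjoint U)) as =
        (\<Sum>bs\<in>ones. \<Sum>cs\<in>ones. coef (mat_adjoint A * pauli d cs * A) bs * (cnj (coef (?Q as) bs) * coef (?Q as) cs))"
      by (simp only: sum_distrib_left mult.left_commute)
  qed
  also have "\<dots> = (\<Sum>bs\<in>ones. \<Sum>cs\<in>ones. \<Sum>as\<in>ones.
        coef (mat_adjoint A * pauli d cs * A) bs * (cnj (coef (?Q as) bs) * coef (?Q as) cs))"
    by (subst sum.swap, rule sum.cong[OF refl], rule sum.swap)
  also have "\<dots> = (\<Sum>bs\<in>ones. \<Sum>cs\<in>ones. if cs = bs then coef (mat_adjoint A * pauli d bs * A) bs else 0)"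
    unfolding sum_distrib_left[symmetric]
    by (intro sum.cong refl) (subst sum_ones_non_entangling[OF assms(1)], auto)
  also have "\<dots> = weight_one_trace A"
    by (simp add: weight_one_trace_def)
  finally show ?thesis .
qed

text \<open>By \<open>weight_one_trace_eq\<close> the average weight is determined by the norm and
  the weight-one trace, both of which are invariant.\<close>

lemma avg_weight_non_entangling_conj:
  assumes "non_entangling d n U" "A \<in> ops"
  shows "avg_weight d n (mat_adjoint U * A * U) = avg_weight d n A"
proof -
  let ?B = "mat_adjoint U * A * U"
  have U: "is_unitary d n U" using assms(1) by (rule non_entangling_unitary)
  have B: "?B \<in> ops" using unitary_in_ops[OF U] assms(2) by auto
  have "ip ?B ?B = ip A A" using U assms(2) by (intro ip_unitary_conj) auto
  then have norm: "(\<Sum>as\<in>labels. (cmod (coef ?B as))\<^sup>2) = (\<Sum>as\<in>labels. (cmod (coef A as))\<^sup>2)"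
    unfolding ip_self[OF B] ip_self[OF assms(2)] by (simp only: of_real_eq_iff)
  \<comment> \<open>The trace lemma has the adjoint on the right, so it is applied to
    \<open>mat_adjoint U\<close>.\<close>
  have "weight_one_trace ?B = weight_one_trace A"
    using weight_one_trace_non_entangling[OF non_entangling_adjoint[OF assms(1)] assms(2)] by simp
  then show ?thesis
    unfolding weight_one_trace_eq[OF B] weight_one_trace_eq[OF assms(2)] norm of_real_eq_iff
    using d_pos by simp
qed

lemma avg_weight_1_non_entangling_conj:
  assumes "non_entangling d n U" "unit_traceless A" "avg_weight d n A = 1"
  shows "unit_traceless (mat_adjoint U * A * U)" "avg_weight d n (mat_adjoint U * A * U) = 1"
  using assms non_entangling_unitary[OF assms(1)]
  by (auto simp: avg_weight_non_entangling_conj unit_traceless_conj unit_traceless_def[of A])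

subsection \<open>Pauli growth\<close>

lemma growth_values_eq:
  "growth_values d n U =
    {avg_weight d n (mat_adjoint U * A * U) - 1 | A. unit_traceless A \<and> avg_weight d n A = 1}"
  by (auto simp: growth_values_def unit_traceless_def n_qudit_ops_def)

text \<open>Coefficient vectors are total functions on lists; fixing them to 0 outside
  \<open>ones\<close> makes the sphere compact in the product topology.\<close>

definition unit_sphere :: "((nat \<times> nat) list \<Rightarrow> complex) set" where
  "unit_sphere = {c. (\<forall>as. as \<notin> ones \<longrightarrow> c as = 0) \<and> (\<Sum>as\<in>ones. (cmod (c as))\<^sup>2) = 1}"

text \<open>The product of closed unit discs and singletons is compact by Tychonoff, and the norm
  equation cuts out a closed subset.\<close>

lemma compact_unit_sphere: "compact unit_sphere"
proof -
  let ?B = "PiE UNIV (\<lambda>as. if as \<in> ones then cball 0 1 else {0 :: complex})"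
  let ?E = "{c :: (nat \<times> nat) list \<Rightarrow> complex. (\<Sum>as\<in>ones. (cmod (c as))\<^sup>2) = 1}"
  have "compactin (product_topology (\<lambda>_. euclidean) UNIV) ?B"
    unfolding compactin_PiE by auto
  then have "compact ?B" by (simp add: euclidean_product_topology)
  moreover have "closed ?E"
    by (intro closed_Collect_eq continuous_intros)
      (auto intro: continuous_on_product_coordinates)
  ultimately have "compact (?B \<inter> ?E)" by (rule compact_Int_closed)
  moreover have "unit_sphere = ?B \<inter> ?E"
  proof (intro equalityI subsetI)
    fix c assume c: "c \<in> unit_sphere"
    have "cmod (c as) \<le> 1" if "as \<in> ones" for as
    proof -
      have "(cmod (c as))\<^sup>2 \<le> (\<Sum>as\<in>ones. (cmod (c as))\<^sup>2)"
        using that by (intro member_le_sum) auto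
      then show ?thesis using c by (simp add: unit_sphere_def power_le_one_iff abs_square_le_1)
    qed
    then show "c \<in> ?B \<inter> ?E" using c by (auto simp: unit_sphere_def)
  qed (auto simp: unit_sphere_def PiE_iff split: if_splits)
  ultimately show ?thesis by simp
qed

text \<open>Passes from operators to coefficient vectors: by \<open>avg_weight_eq_1_iff\<close> the
  admissible operators are the combinations with coefficients on the sphere.\<close>

lemma growth_values_image:
  assumes "U \<in> ops"
  shows "growth_values d n U = (\<lambda>c. avg_weight d n (mat_adjoint U * lincomb c * U) - 1) ` unit_sphere"
proof -
  have "{A. unit_traceless A \<and> avg_weight d n A = 1} = lincomb ` unit_sphere"
  proof (intro equalityI subsetI)
    fix A assume "A \<in> {A. unit_traceless A \<and> avg_weight d n A = 1}"
    then have A: "unit_traceless A" "avg_weight d n A = 1" "A \<in> ops"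
      by (auto simp: unit_traceless_def)
    then have zero: "coef A as = 0" if "as \<in> labels - ones" for as
      using that by (simp add: avg_weight_eq_1_iff)
    have "(\<Sum>as\<in>labels. (cmod (coef A as))\<^sup>2) = (\<Sum>as\<in>ones. (cmod (coef A as))\<^sup>2)"
      using zero by (intro sum_labels_ones) simp
    \<comment> \<open>The cutoff also changes values outside \<open>labels\<close>, as
      \<open>unit_sphere\<close> demands, without changing the operator.\<close>
    moreover define c where "c = (\<lambda>as. if as \<in> ones then coef A as else 0)"
    ultimately have "c \<in> unit_sphere"
      using A by (auto simp: unit_sphere_def unit_traceless_def op_norm2_eq_1_iff cong: sum.cong)
    have "lincomb c = lincomb (coef A)"
      unfolding lincomb_def c_def using zero by (intro cong_mat refl) (auto intro!: sum.cong)
    then have "A = lincomb c" using A by (simp add: lincomb_coef)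
    then show "A \<in> lincomb ` unit_sphere"
      using \<open>c \<in> unit_sphere\<close> by (rule image_eqI)
  next
    fix A assume "A \<in> lincomb ` unit_sphere"
    then obtain c where c: "c \<in> unit_sphere" "A = lincomb c" by auto
    have "(\<Sum>as\<in>labels. (cmod (coef (lincomb c) as))\<^sup>2) = (\<Sum>as\<in>labels. (cmod (c as))\<^sup>2)"
      by (intro sum.cong refl) (simp add: coef_lincomb)
    also have "\<dots> = (\<Sum>as\<in>ones. (cmod (c as))\<^sup>2)"
      using c by (intro sum_labels_ones) (auto simp: unit_sphere_def)
    finally have "op_norm2 d n (lincomb c) = 1"
      using c by (simp add: op_norm2_eq_1_iff unit_sphere_def)
    moreover have "mat_trace (lincomb c) = 0"
      using c by (auto simp: trace_eq_0_iff coef_lincomb unit_sphere_def weight_one_labels_def)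
    ultimately have "unit_traceless (lincomb c)" by (simp add: unit_traceless_def)
    moreover from this have "avg_weight d n (lincomb c) = 1"
      using c by (auto simp: avg_weight_eq_1_iff coef_lincomb unit_sphere_def)
    ultimately show "A \<in> {A. unit_traceless A \<and> avg_weight d n A = 1}" using c by simp
  qed
  then show ?thesis unfolding growth_values_eq setcompr_eq_image by (simp only: image_image)
qed

lemma growth_values_has_max:
  assumes "U \<in> ops" "ones \<noteq> {}"
  shows "\<exists>g\<in>growth_values d n U. \<forall>h\<in>growth_values d n U. h \<le> g"
proof -
  let ?F = "\<lambda>c. avg_weight d n (mat_adjoint U * lincomb c * U) - 1"
  \<comment> \<open>This form involves finitely many coordinates of \<open>c\<close>, from which
    continuity is immediate.\<close>
  have F: "?F = (\<lambda>c. (\<Sum>bs\<in>labels. real (pauli_weight bs) *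
    (cmod (\<Sum>as\<in>labels. coef (mat_adjoint U * pauli d as * U) bs * c as))\<^sup>2) - 1)"
  proof
    fix c show "?F c = (\<Sum>bs\<in>labels. real (pauli_weight bs) *
      (cmod (\<Sum>as\<in>labels. coef (mat_adjoint U * pauli d as * U) bs * c as))\<^sup>2) - 1"
      unfolding avg_weight_conj[OF assms(1) lincomb_in_ops] by (simp add: coef_lincomb cong: sum.cong)
  qed
  have "continuous_on unit_sphere ?F"
    unfolding F
    by (intro continuous_intros) (auto intro: continuous_on_subset[OF continuous_on_product_coordinates])
  \<comment> \<open>A single Pauli operator witnesses that the sphere is nonempty.\<close>
  moreover obtain as0 where "as0 \<in> ones" using assms(2) by auto
  then have "(\<lambda>as. if as = as0 then 1 else 0) \<in> unit_sphere"
    by (auto simp: unit_sphere_def if_distrib[of cmod] if_distrib[of "\<lambda>x. x\<^sup>2"] cong: if_cong)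
  ultimately obtain c where "c \<in> unit_sphere" "\<forall>c'\<in>unit_sphere. ?F c' \<le> ?F c"
    using continuous_attains_sup[OF compact_unit_sphere, of ?F] by auto
  then show ?thesis unfolding growth_values_image[OF assms(1)] by blast
qed

text \<open>Attainment is what gives the \<open>GREATEST\<close> in \<open>pauli_growth\<close> its
  intended value.\<close>

lemma pauli_growth_max:
  assumes "U \<in> ops" "ones \<noteq> {}"
  shows "pauli_growth d n U \<in> growth_values d n U"
    "\<And>h. h \<in> growth_values d n U \<Longrightarrow> h \<le> pauli_growth d n U"
proof -
  obtain g where g: "g \<in> growth_values d n U" "\<forall>h\<in>growth_values d n U. h \<le> g"
    using growth_values_has_max[OF assms] by auto
  then have "pauli_growth d n U = g"
    unfolding pauli_growth_def by (intro Greatest_equality) auto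
  with g show "pauli_growth d n U \<in> growth_values d n U"
    "\<And>h. h \<in> growth_values d n U \<Longrightarrow> h \<le> pauli_growth d n U" by auto
qed

lemma growth_values_nonneg:
  assumes "is_unitary d n U" "g \<in> growth_values d n U"
  shows "g \<ge> 0"
  using assms avg_weight_ge_1 unit_traceless_conj unfolding growth_values_eq by fastforce

text \<open>Weight-one Pauli operators are admissible, so zero growth squeezes their conjugated
  weights to 1. Conversely a non-entangling conjugation preserves average weight, so 0 is the only
  growth value.\<close>

lemma pauli_growth_eq_0_iff:
  assumes "is_unitary d n U" "ones \<noteq> {}"
  shows "pauli_growth d n U = 0 \<longleftrightarrow> non_entangling d n U"
proof
  assume 0: "pauli_growth d n U = 0"
  have "avg_weight d n (mat_adjoint U * pauli d as * U) = 1" if "as \<in> ones" for as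
  proof (rule antisym)
    have ut: "unit_traceless (pauli d as)" using that by (rule unit_traceless_pauli)
    then have "avg_weight d n (pauli d as) = 1"
      using that by (auto simp: avg_weight_eq_1_iff ip_pauli in_ones_labels)
    then have "avg_weight d n (mat_adjoint U * pauli d as * U) - 1 \<in> growth_values d n U"
      using ut unfolding growth_values_eq by auto
    then show "avg_weight d n (mat_adjoint U * pauli d as * U) \<le> 1"
      using pauli_growth_max(2)[OF unitary_in_ops[OF assms(1)] assms(2)] 0 by fastforce
    show "1 \<le> avg_weight d n (mat_adjoint U * pauli d as * U)"
      using ut assms by (intro avg_weight_ge_1 unit_traceless_conj)
  qed
  then show "non_entangling d n U"
    using assms by (auto simp: non_entangling_def weight_one_labels_def)
next
  assume "non_entangling d n U"
  then have "growth_values d n U \<subseteq> {0}"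
    unfolding growth_values_eq by (auto simp: avg_weight_1_non_entangling_conj)
  then show "pauli_growth d n U = 0"
    using pauli_growth_max(1)[OF unitary_in_ops[OF assms(1)] assms(2)] by auto
qed

text \<open>Conjugation by \<open>U2\<close> comes last and leaves the weight unchanged, while
  conjugation by \<open>U1\<close> permutes the admissible operators. Hence the whole value sets
  agree, and with them their maxima.\<close>

lemma growth_values_non_entangling_mult:
  assumes "V \<in> ops" "non_entangling d n U1" "non_entangling d n U2"
  shows "growth_values d n (U1 * V * U2) = growth_values d n V"
proof -
  have U1: "is_unitary d n U1" "U1 \<in> ops" and U2: "U2 \<in> ops"
    using assms non_entangling_unitary unitary_in_ops by blast+
  have eq: "avg_weight d n (mat_adjoint (U1 * V * U2) * A * (U1 * V * U2)) =
      avg_weight d n (mat_adjoint V * (mat_adjoint U1 * A * U1) * V)" if "A \<in> ops" for A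
  proof -
    have "mat_adjoint (U1 * V * U2) * A * (U1 * V * U2) =
        mat_adjoint U2 * (mat_adjoint V * (mat_adjoint U1 * A * U1) * V) * U2"
      using that assms(1) U1(2) U2 by (simp add: mult_assoc mat_adjoint_mult[of _ "d^n" "d^n" _ "d^n"])
    then show ?thesis
      using that assms U1(2) by (simp add: avg_weight_non_entangling_conj)
  qed
  show ?thesis
  proof (intro equalityI subsetI)
    fix g assume "g \<in> growth_values d n (U1 * V * U2)"
    then obtain A where A: "g = avg_weight d n (mat_adjoint (U1 * V * U2) * A * (U1 * V * U2)) - 1"
      "unit_traceless A" "avg_weight d n A = 1" unfolding growth_values_eq by auto
    then have "g = avg_weight d n (mat_adjoint V * (mat_adjoint U1 * A * U1) * V) - 1"
      by (simp add: eq unit_traceless_def)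
    then show "g \<in> growth_values d n V"
      using avg_weight_1_non_entangling_conj[OF assms(2) A(2,3)] unfolding growth_values_eq by blast
  next
    fix g assume "g \<in> growth_values d n V"
    then obtain A where A: "g = avg_weight d n (mat_adjoint V * A * V) - 1"
      "unit_traceless A" "avg_weight d n A = 1" unfolding growth_values_eq by auto
    \<comment> \<open>The preimage of \<open>A\<close> under conjugation by \<open>U1\<close>; it is
      admissible because \<open>mat_adjoint U1\<close> is non-entangling.\<close>
    let ?B = "U1 * A * mat_adjoint U1"
    have B: "unit_traceless ?B" "avg_weight d n ?B = 1"
      using avg_weight_1_non_entangling_conj[OF non_entangling_adjoint[OF assms(2)] A(2,3)] by auto
    have "mat_adjoint U1 * ?B * U1 = A"
      using U1 A by (intro unitary_conj_cancel) (auto simp: unit_traceless_def)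
    then have "g = avg_weight d n (mat_adjoint (U1 * V * U2) * ?B * (U1 * V * U2)) - 1"
      using A(1) B by (simp add: eq unit_traceless_def)
    then show "g \<in> growth_values d n (U1 * V * U2)"
      using B unfolding growth_values_eq by blast
  qed
qed

end

text \<open>The bounds on \<open>d\<close> and \<open>n\<close> enter here: a site must exist and
  carry a nonzero label. The maximum is then taken over a nonempty set.\<close>

lemma weight_one_labels_nonempty:
  assumes "d \<ge> 2" "n \<ge> 1"
  shows "weight_one_labels d n \<noteq> {}"
proof -
  obtain m where n: "n = Suc m" using assms(2) by (cases n) auto
  have "replicate m (0, 0) \<in> pauli_labels d m" "pauli_weight (replicate m (0, 0)) = 0"
    using assms(1) pauli_weight_eq_0_iff[of "replicate m (0, 0)" d m] by auto
  then have "(0, 1) # replicate m (0, 0) \<in> weight_one_labels d n"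
    using assms(1) by (simp add: n weight_one_labels_def Cons_in_pauli_labels pauli_weight_Cons)
  then show ?thesis by blast
qed

theorem mainTheorem1:
  fixes d n :: nat
  assumes "d \<ge> 2" and "n \<ge> 1"
  shows "(\<forall>V. is_unitary d n V \<longrightarrow> pauli_growth d n V \<ge> 0) \<and>
         (\<forall>U. is_unitary d n U \<longrightarrow> (pauli_growth d n U = 0 \<longleftrightarrow> non_entangling d n U)) \<and>
         (\<forall>V U1 U2. is_unitary d n V \<and> non_entangling d n U1 \<and> non_entangling d n U2 \<longrightarrow>
            pauli_growth d n (U1 * V * U2) = pauli_growth d n V)"
proof -
  interpret qudits d n using assms by unfold_locales simp
  have ones: "ones \<noteq> {}" using assms by (rule weight_one_labels_nonempty)
  have "pauli_growth d n V \<ge> 0" if "is_unitary d n V" for V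
    using growth_values_nonneg[OF that] pauli_growth_max(1)[OF unitary_in_ops[OF that] ones] .
  moreover have "pauli_growth d n (U1 * V * U2) = pauli_growth d n V"
    if "is_unitary d n V" "non_entangling d n U1" "non_entangling d n U2" for V U1 U2
    using that growth_values_non_entangling_mult[of V U1 U2] by (simp add: pauli_growth_def unitary_in_ops)
  ultimately show ?thesis using pauli_growth_eq_0_iff ones by blast
qed

end
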